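(* Let $\mathbf{d}=(d_j)_{j\in\mathbb{N}}$ be a complex-valued sequence. Then $\mathbf{d}$ is the diagonal of a unitary operator if and only if $|d_j|\le 1$ for all $j\in\mathbb{N}$ and $$2\Bigl(1-\inf_{j\in\mathbb{N}}|d_j|\Bigr)\le \sum_{j\in\mathbb{N}}\bigl(1-|d_j|\bigr),$$ where the sum on the right is allowed to be $+\infty$. Moreover, if $\mathbf{d}$ is real-valued then the same statement holds over real Hilbert space: $\mathbf{d}$ is the diagonal of a unitary (i.e. orthogonal) operator on a real Hilbert space if and only if these same two conditions hold.
   Context: Hilbert spaces are separable and infinite-dimensional (with orthonormal bases indexed by $\mathbb{N}$), complex unless stated otherwise. A sequence $\mathbf{d}=(d_j)_{j=1}^\infty$ is a diagonal of an operator $A$ if there is an orthonormal basis $\{e_j\}_{j=1}^\infty$ of the space with $\langle Ae_j,e_j\rangle=d_j$ for all $j$. *)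

theory Defs
  imports "HOL-Analysis.Analysis"
begin

text \<open>
  A complex inner product space is presented as a real inner product space carrying a compatible
  complex structure: the real inner product is the real part of the complex one, so norm, topology
  and completeness are those of the library, and positive definiteness of the complex inner product
  is inherited from \<^class>\<open>real_inner\<close>. The complex inner product is linear in its first argument.
  A complex Hilbert space is a type of sort \<open>{complex_inner, complete_space}\<close>, a real one a type
  of sort \<open>{real_inner, complete_space}\<close>.
\<close>

class complex_inner = real_inner +
  fixes scaleC :: "complex \<Rightarrow> 'a \<Rightarrow> 'a"  (infixr "*\<^sub>C" 75)
    and cinner :: "'a \<Rightarrow> 'a \<Rightarrow> complex"
  assumes scaleC_add_right: "a *\<^sub>C (x + y) = a *\<^sub>C x + a *\<^sub>C y"
    and scaleC_add_left: "(a + b) *\<^sub>C x = a *\<^sub>C x + b *\<^sub>C x"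
    and scaleC_scaleC: "a *\<^sub>C (b *\<^sub>C x) = (a * b) *\<^sub>C x"
    and scaleC_complex_of_real: "complex_of_real r *\<^sub>C x = r *\<^sub>R x"
    and cinner_commute: "cinner x y = cnj (cinner y x)"
    and cinner_add_left: "cinner (x + y) z = cinner x z + cinner y z"
    and cinner_scaleC_left: "cinner (a *\<^sub>C x) y = a * cinner x y"
    and inner_eq_Re_cinner: "inner x y = Re (cinner x y)"

global_interpretation complex_vector: vector_space "scaleC :: complex \<Rightarrow> 'a \<Rightarrow> 'a::complex_inner"
  defines cspan = complex_vector.span
proof unfold_locales
  show "1 *\<^sub>C x = x" for x :: 'a
    using scaleC_complex_of_real[of 1 x] by simp
qed (simp_all add: scaleC_add_right scaleC_add_left scaleC_scaleC)

definition complex_onb :: "(nat \<Rightarrow> 'a::complex_inner) \<Rightarrow> bool" where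
  "complex_onb e \<longleftrightarrow>
     (\<forall>i j. cinner (e i) (e j) = (if i = j then 1 else 0)) \<and> closure (cspan (range e)) = UNIV"

definition real_onb :: "(nat \<Rightarrow> 'a::real_inner) \<Rightarrow> bool" where
  "real_onb e \<longleftrightarrow>
     (\<forall>i j. inner (e i) (e j) = (if i = j then 1 else 0)) \<and> closure (span (range e)) = UNIV"

text \<open>In infinite dimension preservation of the inner product does not imply surjectivity,
  which is therefore required separately in the next two definitions.\<close>

definition unitary_operator :: "('a::complex_inner \<Rightarrow> 'a) \<Rightarrow> bool" where
  "unitary_operator U \<longleftrightarrow>
     Vector_Spaces.linear scaleC scaleC U \<and> (\<forall>x y. cinner (U x) (U y) = cinner x y) \<and> surj U"

definition orthogonal_operator :: "('a::real_inner \<Rightarrow> 'a) \<Rightarrow> bool" where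
  "orthogonal_operator U \<longleftrightarrow> orthogonal_transformation U \<and> surj U"

definition complex_diagonal_of :: "(nat \<Rightarrow> complex) \<Rightarrow> ('a::complex_inner \<Rightarrow> 'a) \<Rightarrow> bool" where
  "complex_diagonal_of d A \<longleftrightarrow> (\<exists>e. complex_onb e \<and> (\<forall>j. cinner (A (e j)) (e j) = d j))"

definition real_diagonal_of :: "(nat \<Rightarrow> real) \<Rightarrow> ('a::real_inner \<Rightarrow> 'a) \<Rightarrow> bool" where
  "real_diagonal_of d A \<longleftrightarrow> (\<exists>e. real_onb e \<and> (\<forall>j. inner (A (e j)) (e j) = d j))"

end

theory Submission
  imports Defs
begin

text \<open>
  An operator with diagonal \<open>d\<close> in the basis \<open>e\<close> is unitary exactly if it carries \<open>e\<close> to another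
  orthonormal basis \<open>f\<close>, and then \<open>\<langle>f j, e j\<rangle> = d j\<close>. The question is therefore which numbers are the
  mutual inner products of two orthonormal bases. Multiplying the \<open>f j\<close> by scalars of modulus 1
  reduces it to the numbers \<open>\<bar>d j\<bar>\<close>, or to the defects \<open>\<delta> j = 1 - \<bar>d j\<bar>\<close>. Only real linear
  combinations are used after that, so the real and the complex case have the same proof.

  The condition of the theorem is a polygon inequality: no \<open>\<delta> k\<close> exceeds the sum of the others.
  It is necessary (\<open>onb_defect_le\<close>) because for \<open>j \<noteq> k\<close> the vectors \<open>f j\<close> and \<open>e j\<close> are orthogonal
  to \<open>f k\<close> and to \<open>e k\<close> respectively. Their components in the plane of \<open>f k\<close> and \<open>e k\<close> lie on two
  lines whose unit vectors have an inner product of modulus \<open>\<bar>d k\<bar>\<close> only. This forces a defect at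
  \<open>j\<close> in proportion to the squared lengths of the components, and by Parseval's identity these
  defects add up to at least \<open>1 - \<bar>d k\<bar>\<close>.

  For the converse, suppose first that there are finitely many indices. Rotations of \<open>e\<close> and \<open>f\<close>
  in a coordinate plane can replace the
  defects \<open>t, 0\<close> by \<open>x, y\<close> whenever \<open>t, x, y\<close> are the sides of a triangle, and a polygon is cut
  into triangles by its diagonals (\<open>polygon_block\<close>). If the sum of all defects diverges, then the
  indices are divided into finite blocks with defect sum at least 2 each. The polygon inequality
  holds in each block, because no defect exceeds 1 (\<open>polygon_blocks\<close>,
  \<open>divergent_series_blocks\<close>). If the sum converges, then
  a tail of small sum \<open>T\<close> serves as the last side of a finite polygon. Afterwards
  a reflection distributes \<open>T\<close> over the infinitely many indices of the tail (\<open>split_defect\<close>,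
  \<open>exists_onbs_summable\<close>). The reflection maps the whole space onto itself, so
  the completeness of the bases is preserved, which is not automatic for an infinite sequence of
  plane rotations.
\<close>

section \<open>Hilbert spaces over the real or the complex numbers\<close>

text \<open>
  The field of scalars \<open>K\<close>, which stands for the real or the complex numbers, is seen inside the
  complex numbers, so that \<open>ip\<close> is complex-valued in both cases. The function \<open>scale\<close> is
  meaningful only on scalars from \<open>K\<close>.
\<close>

locale hilbert_over =
  fixes K :: "complex set"
    and scale :: "complex \<Rightarrow> 'a::{real_inner, complete_space} \<Rightarrow> 'a"
    and ip :: "'a \<Rightarrow> 'a \<Rightarrow> complex"
  assumes K_real: "complex_of_real r \<in> K"
    and K_mult: "a \<in> K \<Longrightarrow> b \<in> K \<Longrightarrow> a * b \<in> K"
    and K_cnj: "a \<in> K \<Longrightarrow> cnj a \<in> K"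
    and ip_in_K: "ip x y \<in> K"
    and ip_add: "ip (x + y) z = ip x z + ip y z"
    and ip_scale: "a \<in> K \<Longrightarrow> ip (scale a x) y = a * ip x y"
    and ip_commute: "ip x y = cnj (ip y x)"
    and Re_ip: "Re (ip x y) = inner x y"
    and scale_of_real: "scale (complex_of_real r) x = r *\<^sub>R x"
begin

lemma ip_scaleR: "ip (r *\<^sub>R x) y = of_real r * ip x y"
  using ip_scale[OF K_real] by (simp add: scale_of_real)

lemma ip_scaleR_right: "ip x (r *\<^sub>R y) = of_real r * ip x y"
  by (subst (1 2) ip_commute) (simp add: ip_scaleR)

lemma ip_scale_right: "a \<in> K \<Longrightarrow> ip x (scale a y) = cnj a * ip x y"
  by (subst (1 2) ip_commute) (simp add: ip_scale)

lemma ip_add_right: "ip x (y + z) = ip x y + ip x z"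
  by (subst (1 2 3) ip_commute) (simp add: ip_add)

lemma ip_minus: "ip (- x) y = - ip x y"
  using ip_scaleR[of "-1" x y] by simp

lemma ip_minus_right: "ip x (- y) = - ip x y"
  using ip_scaleR_right[of x "-1" y] by simp

lemma ip_diff: "ip (x - y) z = ip x z - ip y z"
  using ip_add[of x "- y" z] by (simp add: ip_minus)

lemma ip_diff_right: "ip x (y - z) = ip x y - ip x z"
  using ip_add_right[of x y "- z"] by (simp add: ip_minus_right)

lemma ip_zero: "ip 0 y = 0"
  using ip_scaleR[of 0 0 y] by simp

lemma ip_zero_right: "ip x 0 = 0"
  using ip_scaleR_right[of x 0 0] by simp

lemmas ip_linear =
  ip_add ip_add_right ip_diff ip_diff_right ip_minus ip_minus_right ip_zero ip_zero_right
  ip_scaleR ip_scaleR_right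

lemma ip_sum: "ip (\<Sum>i\<in>A. g i) y = (\<Sum>i\<in>A. ip (g i) y)"
  by (induction A rule: infinite_finite_induct) (auto simp: ip_linear)

lemma ip_sum_right: "ip x (\<Sum>i\<in>A. g i) = (\<Sum>i\<in>A. ip x (g i))"
  by (induction A rule: infinite_finite_induct) (auto simp: ip_linear)

lemma ip_self: "ip x x = of_real ((norm x)\<^sup>2)"
proof (rule complex_eqI)
  show "Re (ip x x) = Re (of_real ((norm x)\<^sup>2))"
    by (simp add: Re_ip power2_norm_eq_inner)
  have "Im (ip x x) = - Im (ip x x)"
    by (subst ip_commute) simp
  then show "Im (ip x x) = Im (of_real ((norm x)\<^sup>2))" by simp
qed

lemma norm_scale: assumes "a \<in> K" shows "norm (scale a x) = cmod a * norm x"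
proof -
  have "complex_of_real ((norm (scale a x))\<^sup>2) = a * cnj a * ip x x"
    unfolding ip_self[symmetric] using assms by (simp add: ip_scale ip_scale_right)
  also have "\<dots> = of_real ((cmod a * norm x)\<^sup>2)"
    by (simp add: ip_self complex_norm_square[symmetric] power_mult_distrib)
  finally have "(norm (scale a x))\<^sup>2 = (cmod a * norm x)\<^sup>2"
    unfolding of_real_eq_iff .
  then show ?thesis by (simp add: power2_eq_iff_nonneg)
qed

lemma unimodular_factor:
  assumes "z \<in> K" obtains w where "w \<in> K" "cmod w = 1" "z = w * of_real (cmod z)"
proof (cases "z = 0")
  case True
  then show ?thesis using that[of 1] K_real[of 1] by simp
next
  case False
  have "of_real (1 / cmod z) * z \<in> K" using K_mult[OF K_real assms] .
  moreover have "cmod (of_real (1 / cmod z) * z) = 1" using False by (simp add: norm_divide)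
  moreover have "z = of_real (1 / cmod z) * z * of_real (cmod z)" using False by simp
  ultimately show ?thesis using that by blast
qed

lemma cmod_ip_le: "cmod (ip x y) \<le> norm x * norm y"
proof -
  obtain w where w: "w \<in> K" "cmod w = 1" "ip x y = w * of_real (cmod (ip x y))"
    using unimodular_factor[OF ip_in_K] .
  have "ip (scale (cnj w) x) y = cnj w * w * of_real (cmod (ip x y))"
    using w K_cnj by (simp add: ip_scale mult.assoc)
  also have "\<dots> = of_real (cmod (ip x y))"
    using w(2) complex_norm_square[of w] by (simp add: mult.commute)
  finally have "cmod (ip x y) = inner (scale (cnj w) x) y"
    using Re_ip[of "scale (cnj w) x" y] by simp
  also have "\<dots> \<le> norm x * norm y"
    using norm_cauchy_schwarz[of "scale (cnj w) x" y] w K_cnj by (simp add: norm_scale)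
  finally show ?thesis .
qed

lemma tendsto_ip: assumes "(g \<longlongrightarrow> x) F" shows "((\<lambda>n. ip (g n) y) \<longlongrightarrow> ip x y) F"
proof -
  have "((\<lambda>n. norm (g n - x) * norm y) \<longlongrightarrow> 0) F"
    using assms by (intro tendsto_mult_left_zero) (simp add: LIM_zero tendsto_norm_zero_iff)
  then have "((\<lambda>n. ip (g n) y - ip x y) \<longlongrightarrow> 0) F"
    by (rule Lim_null_comparison[rotated])
      (rule always_eventually, simp add: ip_diff[symmetric] cmod_ip_le)
  then show ?thesis by (simp add: LIM_zero_iff)
qed

section \<open>Orthonormal families and bases\<close>

definition orthonormal_on :: "'i set \<Rightarrow> ('i \<Rightarrow> 'a) \<Rightarrow> bool" where
  "orthonormal_on A e \<longleftrightarrow> (\<forall>i\<in>A. \<forall>j\<in>A. ip (e i) (e j) = (if i = j then 1 else 0))"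

text \<open>Completeness of an orthonormal sequence is expressed by the triviality of its orthogonal
  complement, which is easier to carry through the constructions than density of the span.\<close>

definition onb :: "(nat \<Rightarrow> 'a) \<Rightarrow> bool" where
  "onb e \<longleftrightarrow> orthonormal_on UNIV e \<and> (\<forall>x. (\<forall>j. ip x (e j) = 0) \<longrightarrow> x = 0)"

lemma orthonormal_onD:
  "orthonormal_on A e \<Longrightarrow> i \<in> A \<Longrightarrow> j \<in> A \<Longrightarrow> ip (e i) (e j) = (if i = j then 1 else 0)"
  unfolding orthonormal_on_def by blast

lemma orthonormal_on_subset: "orthonormal_on A e \<Longrightarrow> B \<subseteq> A \<Longrightarrow> orthonormal_on B e"
  unfolding orthonormal_on_def by blast

lemma onb_ip: "onb e \<Longrightarrow> ip (e i) (e j) = (if i = j then 1 else 0)"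
  unfolding onb_def orthonormal_on_def by blast

lemma onb_total: "onb e \<Longrightarrow> (\<And>j. ip x (e j) = 0) \<Longrightarrow> x = 0"
  unfolding onb_def by blast

lemma onb_norm: "onb e \<Longrightarrow> norm (e i) = 1"
proof -
  assume "onb e"
  then have "complex_of_real ((norm (e i))\<^sup>2) = of_real 1"
    using onb_ip[of e i i] by (simp add: ip_self)
  then have "(norm (e i))\<^sup>2 = 1" unfolding of_real_eq_iff .
  then show ?thesis by (simp add: power2_eq_1_iff) (use norm_ge_zero[of "e i"] in linarith)
qed

lemma ip_orthonormal_sum:
  assumes "finite A" "orthonormal_on B e" "A \<subseteq> B" "j \<in> B" "\<And>i. i \<in> A \<Longrightarrow> c i \<in> K"
  shows "ip (\<Sum>i\<in>A. scale (c i) (e i)) (e j) = (if j \<in> A then c j else 0)"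
proof -
  have "ip (\<Sum>i\<in>A. scale (c i) (e i)) (e j) = (\<Sum>i\<in>A. if i = j then c i else 0)"
    unfolding ip_sum
    by (intro sum.cong) (use assms orthonormal_onD[OF assms(2)] in \<open>auto simp: ip_scale\<close>)
  then show ?thesis using assms(1) by simp
qed

lemma norm_orthonormal_sum:
  assumes "finite A" "orthonormal_on A e" "\<And>i. i \<in> A \<Longrightarrow> c i \<in> K"
  shows "(norm (\<Sum>i\<in>A. scale (c i) (e i)))\<^sup>2 = (\<Sum>i\<in>A. (cmod (c i))\<^sup>2)"
proof -
  let ?S = "\<Sum>i\<in>A. scale (c i) (e i)"
  have "ip ?S ?S = (\<Sum>i\<in>A. cnj (c i) * ip ?S (e i))"
    unfolding ip_sum_right[of ?S] using assms(3) by (simp add: ip_scale_right)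
  also have "\<dots> = (\<Sum>i\<in>A. cnj (c i) * c i)"
    by (intro sum.cong) (use assms ip_orthonormal_sum[OF assms(1,2)] in auto)
  also have "\<dots> = of_real (\<Sum>i\<in>A. (cmod (c i))\<^sup>2)"
    using complex_norm_square by (simp add: mult.commute)
  finally show ?thesis unfolding ip_self of_real_eq_iff .
qed

text \<open>The Riesz--Fischer theorem.\<close>

lemma orthonormal_series:
  fixes e :: "nat \<Rightarrow> 'a"
  assumes e: "orthonormal_on UNIV e" and K: "\<And>i. c i \<in> K"
    and summable: "summable (\<lambda>i. (cmod (c i))\<^sup>2)"
  obtains v where "(\<lambda>n. \<Sum>i<n. scale (c i) (e i)) \<longlonglongrightarrow> v" "\<And>j. ip v (e j) = c j"
    "(norm v)\<^sup>2 = (\<Sum>i. (cmod (c i))\<^sup>2)"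
proof -
  let ?S = "\<lambda>n. \<Sum>i<n. scale (c i) (e i)"
  let ?N = "\<lambda>n. \<Sum>i<n. (cmod (c i))\<^sup>2"
  have "Cauchy ?S"
  proof (rule metric_CauchyI)
    fix r :: real assume r: "r > 0"
    have "Cauchy ?N"
      using summable by (simp add: summable_iff_convergent Cauchy_convergent_iff)
    then obtain M where M: "\<And>m n. m \<ge> M \<Longrightarrow> n \<ge> M \<Longrightarrow> dist (?N m) (?N n) < r\<^sup>2"
      using r unfolding Cauchy_def by (meson zero_less_power)
    have close: "dist (?S m) (?S n) < r" if mn: "m \<ge> n" "n \<ge> M" for m n
    proof -
      have "(dist (?S m) (?S n))\<^sup>2 = (norm (\<Sum>i\<in>{n..<m}. scale (c i) (e i)))\<^sup>2"
        using sum_diff_nat_ivl[of 0 n m "\<lambda>i. scale (c i) (e i)"] mn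
        by (simp add: dist_norm atLeast0LessThan)
      also have "\<dots> = (\<Sum>i\<in>{n..<m}. (cmod (c i))\<^sup>2)"
        using K e by (intro norm_orthonormal_sum) (auto intro: orthonormal_on_subset)
      also have "\<dots> = ?N m - ?N n"
        using sum_diff_nat_ivl[of 0 n m "\<lambda>i. (cmod (c i))\<^sup>2"] mn by (simp add: atLeast0LessThan)
      also have "\<dots> < r\<^sup>2" using M[of m n] mn by (simp add: dist_real_def)
      finally show ?thesis using r by (simp add: power_less_imp_less_base)
    qed
    have "dist (?S m) (?S n) < r" if "m \<ge> M" "n \<ge> M" for m n
      using close[of n m] close[of m n] that by (metis dist_commute le_cases)
    then show "\<exists>M. \<forall>m\<ge>M. \<forall>n\<ge>M. dist (?S m) (?S n) < r" by blast
  qed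
  then obtain v where v: "?S \<longlonglongrightarrow> v" using Cauchy_convergent_iff convergent_def by blast
  have coeff: "ip v (e j) = c j" for j
  proof -
    have "(\<lambda>n. ip (?S n) (e j)) \<longlonglongrightarrow> ip v (e j)" by (rule tendsto_ip[OF v])
    moreover have "(\<lambda>n. ip (?S n) (e j)) \<longlonglongrightarrow> c j"
    proof (rule tendsto_eventually)
      show "\<forall>\<^sub>F n in sequentially. ip (?S n) (e j) = c j"
        using eventually_gt_at_top[of j]
        by eventually_elim (use ip_orthonormal_sum[OF _ e] K in auto)
    qed
    ultimately show ?thesis by (rule LIMSEQ_unique)
  qed
  have "(\<lambda>n. (norm (?S n))\<^sup>2) \<longlonglongrightarrow> (norm v)\<^sup>2" using v by (intro tendsto_intros)
  moreover have "(norm (?S n))\<^sup>2 = ?N n" for n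
    using K e by (intro norm_orthonormal_sum) (auto intro: orthonormal_on_subset)
  ultimately have "(norm v)\<^sup>2 = (\<Sum>i. (cmod (c i))\<^sup>2)"
    using summable_LIMSEQ[OF summable] LIMSEQ_unique by auto
  then show ?thesis using that v coeff by blast
qed

lemma onb_expansion:
  assumes "onb e"
  shows "(\<lambda>n. \<Sum>i<n. scale (ip x (e i)) (e i)) \<longlonglongrightarrow> x" (is ?expansion)
    and "(\<lambda>i. (cmod (ip x (e i)))\<^sup>2) sums (norm x)\<^sup>2" (is ?parseval)
proof -
  let ?c = "\<lambda>i. ip x (e i)"
  let ?S = "\<lambda>n. \<Sum>i<n. scale (?c i) (e i)"
  have e: "orthonormal_on UNIV e" using assms by (simp add: onb_def)
  have "(\<Sum>i<n. (cmod (?c i))\<^sup>2) \<le> (norm x)\<^sup>2" for n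
  proof -
    have sq: "(norm (?S n))\<^sup>2 = (\<Sum>i<n. (cmod (?c i))\<^sup>2)"
      using ip_in_K e by (intro norm_orthonormal_sum) (auto intro: orthonormal_on_subset)
    have "ip x (?S n) = (\<Sum>i<n. cnj (?c i) * ?c i)"
      by (simp add: ip_sum_right ip_scale_right ip_in_K)
    also have "\<dots> = of_real (\<Sum>i<n. (cmod (?c i))\<^sup>2)"
      using complex_norm_square by (simp add: mult.commute)
    finally have "inner x (?S n) = (norm (?S n))\<^sup>2" unfolding Re_ip[symmetric] sq by simp
    then have "0 \<le> (norm x)\<^sup>2 - (norm (?S n))\<^sup>2"
      using zero_le_power2[of "norm (x - ?S n)"]
      by (simp add: power2_norm_eq_inner inner_diff inner_commute)
    then show ?thesis using sq by simp
  qed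
  then have summable: "summable (\<lambda>i. (cmod (?c i))\<^sup>2)"
    by (intro bounded_imp_summable[where B = "(norm x)\<^sup>2"])
      (auto simp only: lessThan_Suc_atMost[symmetric] zero_le_power2)
  from orthonormal_series[OF e ip_in_K summable] obtain v where
    v: "?S \<longlonglongrightarrow> v" "\<And>j. ip v (e j) = ?c j" "(norm v)\<^sup>2 = (\<Sum>i. (cmod (?c i))\<^sup>2)" by blast
  have "x - v = 0" using v(2) by (intro onb_total[OF assms]) (simp add: ip_diff)
  then have "v = x" by simp
  with v(1) show ?expansion by simp
  show ?parseval using summable_sums[OF summable] v(3) \<open>v = x\<close> by simp
qed

section \<open>Existence of orthonormal bases\<close>

text \<open>
  A maximal orthonormal set has a trivial orthogonal complement. It is countable because its members
  have mutual distance \<open>sqrt 2\<close>, so that balls of radius \<open>1 / 2\<close> around them contain different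
  members of a dense countable set.
\<close>

lemma exists_onb:
  assumes separable: "separable_space (euclidean :: 'a topology)"
    and infinite_dim: "\<And>B. finite B \<Longrightarrow> orthonormal_on B id \<Longrightarrow>
      \<exists>x. x \<noteq> (\<Sum>b\<in>B. scale (ip x b) b)"
  obtains e where "onb e"
proof -
  let ?\<A> = "{B. orthonormal_on B id}"
  have "\<exists>B\<in>?\<A>. \<forall>X\<in>?\<A>. B \<subseteq> X \<longrightarrow> X = B"
  proof (rule subset_Zorn')
    fix \<C> assume "subset.chain ?\<A> \<C>"
    then have \<C>: "\<C> \<subseteq> ?\<A>" "\<And>X Y. X \<in> \<C> \<Longrightarrow> Y \<in> \<C> \<Longrightarrow> X \<subseteq> Y \<or> Y \<subseteq> X"
      by (auto simp: subset_chain_def)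
    have "ip x y = (if x = y then 1 else 0)" if xy: "x \<in> \<Union>\<C>" "y \<in> \<Union>\<C>" for x y
    proof -
      obtain X where "X \<in> \<C>" "x \<in> X" "y \<in> X" using xy \<C>(2) by blast
      then show ?thesis using \<C>(1) orthonormal_onD[of X id x y] by auto
    qed
    then show "\<Union>\<C> \<in> ?\<A>" by (simp add: orthonormal_on_def)
  qed
  then obtain B where B: "orthonormal_on B id"
    and maximal: "\<And>X. orthonormal_on X id \<Longrightarrow> B \<subseteq> X \<Longrightarrow> X = B" by blast
  have ipB: "ip x y = (if x = y then 1 else 0)" if "x \<in> B" "y \<in> B" for x y
    using orthonormal_onD[OF B that] by simp
  have total: "x = 0" if x: "\<And>b. b \<in> B \<Longrightarrow> ip x b = 0" for x
  proof (rule ccontr)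
    assume "x \<noteq> 0"
    define y where "y = (1 / norm x) *\<^sub>R x"
    have "norm y = 1" using \<open>x \<noteq> 0\<close> by (simp add: y_def)
    then have yy: "ip y y = 1" by (simp add: ip_self)
    have yb: "ip y b = 0" "ip b y = 0" if "b \<in> B" for b
      using x[OF that] ip_commute[of b y] by (simp_all add: y_def ip_linear)
    have "y \<notin> B" using yb(1)[of y] yy by auto
    moreover from this have "orthonormal_on (insert y B) id"
      using yy yb B by (auto simp: orthonormal_on_def)
    then have "y \<in> B" using maximal[of "insert y B"] by blast
    ultimately show False by blast
  qed
  have "infinite B"
  proof
    assume "finite B"
    then obtain x where x: "x \<noteq> (\<Sum>b\<in>B. scale (ip x b) b)" using infinite_dim B by blast
    have "x - (\<Sum>b\<in>B. scale (ip x b) b) = 0"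
    proof (rule total)
      fix b assume "b \<in> B"
      then show "ip (x - (\<Sum>b\<in>B. scale (ip x b) b)) b = 0"
        using ip_orthonormal_sum[OF \<open>finite B\<close> B, of b "\<lambda>b. ip x b"] ip_in_K
        by (simp add: ip_diff)
    qed
    with x show False by simp
  qed
  moreover have "countable B"
  proof -
    obtain C where C: "countable C" "closure C = (UNIV :: 'a set)"
      using separable by (auto simp: separable_space_def)
    then have "\<exists>c\<in>C. dist c b < 1 / 2" for b
      using closure_approachable[of b C] by (metis UNIV_I half_gt_zero zero_less_one)
    then obtain g where g: "\<And>b. g b \<in> C" "\<And>b. dist (g b) b < 1 / 2" by metis
    have "inj_on g B"
    proof
      fix x y assume xy: "x \<in> B" "y \<in> B" "g x = g y"
      show "x = y"
      proof (rule ccontr)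
        assume "x \<noteq> y"
        then have "ip (x - y) (x - y) = 2" using xy ipB by (simp add: ip_linear)
        then have "(dist x y)\<^sup>2 = 2"
          unfolding ip_self dist_norm by (metis of_real_eq_iff of_real_numeral)
        moreover have "dist x y < 1"
          using g(2)[of x] g(2)[of y] xy(3) dist_triangle_half_r[of "g x" x 1 y] by simp
        ultimately show False
          using power_strict_mono[of "dist x y" 1 2] by simp
      qed
    qed
    then show ?thesis using C(1) g(1) by (meson countable_image_inj_on countable_subset image_subsetI)
  qed
  ultimately obtain e :: "nat \<Rightarrow> 'a" where e: "bij_betw e UNIV B"
    using bij_betw_from_nat_into by blast
  then have "orthonormal_on UNIV e"
    using ipB unfolding orthonormal_on_def bij_betw_def inj_on_def by auto
  moreover have "x = 0" if "\<And>j. ip x (e j) = 0" for x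
    using that e by (intro total) (auto simp: bij_betw_def)
  ultimately show ?thesis using that unfolding onb_def by blast
qed

section \<open>The necessary condition\<close>

text \<open>
  The vectors \<open>g'\<close> and \<open>h'\<close> lie in the plane of \<open>g\<close> and \<open>h\<close>, orthogonal to \<open>g\<close> and to \<open>h\<close>
  respectively, and after normalization their inner product has modulus \<open>c\<close>. The components of \<open>x\<close>
  and \<open>y\<close> in that plane are multiples of \<open>g'\<close> and \<open>h'\<close>, hence they contribute to \<open>ip x y\<close> with
  the factor \<open>c\<close>. The rest is the Cauchy--Schwarz inequality, followed by the
  inequality between arithmetic and geometric mean.
\<close>

lemma cmod_ip_le_of_orthogonal:
  fixes g h
  defines "c \<equiv> cmod (ip g h)" and "g' \<equiv> h - scale (ip h g) g" and "h' \<equiv> g - scale (ip g h) h"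
  assumes unit: "norm g = 1" "norm h = 1" "norm x = 1" "norm y = 1"
    and orth: "ip x g = 0" "ip y h = 0" and c: "c < 1"
  shows "(norm g')\<^sup>2 = 1 - c\<^sup>2" "(norm h')\<^sup>2 = 1 - c\<^sup>2"
    "(1 - c) * ((cmod (ip g' x))\<^sup>2 / (1 - c\<^sup>2) + (cmod (ip h' y))\<^sup>2 / (1 - c\<^sup>2)) / 2
      \<le> 1 - cmod (ip x y)"
proof -
  define z where "z = ip g h"
  define r where "r = 1 - c\<^sup>2"
  have "0 \<le> c" by (simp add: c_def)
  have "c\<^sup>2 < 1" using c \<open>0 \<le> c\<close> by (simp add: power_less_one_iff abs_square_less_1)
  then have r: "r > 0" by (simp add: r_def)
  have hg: "ip h g = cnj z" unfolding z_def by (rule ip_commute)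
  have gg: "ip g g = 1" "ip h h = 1" using unit by (simp_all add: ip_self)
  have zz: "z * cnj z = of_real (1 - r)" "cnj z * z = of_real (1 - r)"
    using complex_norm_square[of z] by (simp_all add: r_def c_def z_def mult.commute)
  have zK: "z \<in> K" "cnj z \<in> K" using ip_in_K K_cnj unfolding z_def by blast+
  have g': "g' = h - scale (cnj z) g" and h': "h' = g - scale z h"
    by (simp_all add: g'_def h'_def hg z_def)
  have g'g': "ip g' g = 0" "ip g' h = of_real r" "ip g' g' = of_real r"
    using gg zz zK hg z_def[symmetric] unfolding g'
    by (simp_all add: ip_linear ip_scale ip_scale_right)
  have h'h': "ip h' h = 0" "ip h' g = of_real r" "ip h' h' = of_real r"
    using gg zz zK hg z_def[symmetric] unfolding h'
    by (simp_all add: ip_linear ip_scale ip_scale_right)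
  have g'h': "ip g' h' = - cnj z * of_real r"
    using g'g' zK unfolding h' by (simp add: ip_linear ip_scale_right)
  show norms: "(norm g')\<^sup>2 = 1 - c\<^sup>2" "(norm h')\<^sup>2 = 1 - c\<^sup>2"
    using g'g'(3) h'h'(3) unfolding ip_self of_real_eq_iff r_def by simp_all
  define a where "a = ip x g' / of_real r"
  define b where "b = ip y h' / of_real r"
  have K: "a \<in> K" "b \<in> K"
    using K_mult[OF K_real[of "1 / r"] ip_in_K] by (simp_all add: a_def b_def)
  define x0 where "x0 = x - scale a g'"
  define y0 where "y0 = y - scale b h'"
  have swap: "ip v w = 0" if "ip w v = 0" for v w using that ip_commute[of v w] by simp
  have x0: "ip x0 g' = 0" "ip x0 g = 0"
    using r K g'g' orth by (simp_all add: x0_def ip_linear ip_scale a_def)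
  have y0: "ip y0 h' = 0" "ip y0 h = 0"
    using r K h'h' orth by (simp_all add: y0_def ip_linear ip_scale b_def)
  have "ip x0 h = 0"
    using x0 zK by (simp add: g' ip_linear ip_scale_right)
  then have x0h': "ip x0 h' = 0" using x0 zK by (simp add: h' ip_linear ip_scale_right)
  have "ip y0 g = 0"
    using y0 zK by (simp add: h' ip_linear ip_scale_right)
  then have "ip y0 g' = 0"
    using y0 zK by (simp add: g' ip_linear ip_scale_right)
  then have y0g': "ip g' y0 = 0" by (rule swap)
  define A where "A = (cmod (ip g' x))\<^sup>2 / r"
  define B where "B = (cmod (ip h' y))\<^sup>2 / r"
  have cmod_swap: "cmod (ip v w) = cmod (ip w v)" for v w
    using ip_commute[of v w] complex_mod_cnj by metis
  have "cmod a = cmod (ip g' x) / r" "cmod b = cmod (ip h' y) / r"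
    unfolding a_def b_def norm_divide cmod_swap[of x] cmod_swap[of y] using r by simp_all
  then have A: "A = r * (cmod a)\<^sup>2" and B: "B = r * (cmod b)\<^sup>2"
    using r unfolding A_def B_def by (simp_all add: power_divide power2_eq_square)
  have x_split: "x = scale a g' + x0" and y_split: "y = scale b h' + y0"
    by (simp_all add: x0_def y0_def)
  have "ip x x = of_real A + ip x0 x0"
    unfolding A using x0 swap[OF x0(1)] K g'g'(3) complex_norm_square[of a]
    by (subst (1 2) x_split) (simp add: ip_linear ip_scale ip_scale_right algebra_simps)
  then have nx: "(norm x0)\<^sup>2 = 1 - A"
    using unit unfolding ip_self by (metis add_diff_cancel_left' of_real_add of_real_eq_iff power_one)
  have "ip y y = of_real B + ip y0 y0"
    unfolding B using y0 swap[OF y0(1)] K h'h'(3) complex_norm_square[of b]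
    by (subst (1 2) y_split) (simp add: ip_linear ip_scale ip_scale_right algebra_simps)
  then have ny: "(norm y0)\<^sup>2 = 1 - B"
    using unit unfolding ip_self by (metis add_diff_cancel_left' of_real_add of_real_eq_iff power_one)
  have "ip x y = a * cnj b * ip g' h' + ip x0 y0"
    using x0h' y0g' K by (subst x_split, subst y_split) (simp add: ip_linear ip_scale ip_scale_right)
  then have "cmod (ip x y) \<le> cmod (a * cnj b * ip g' h') + cmod (ip x0 y0)"
    using norm_triangle_ineq by simp
  also have "\<dots> \<le> c * (r * (cmod a * cmod b)) + norm x0 * norm y0"
    using cmod_ip_le[of x0 y0] r
    by (simp add: g'h' norm_mult c_def z_def mult_ac)
  also have "\<dots> \<le> c * (r * (((cmod a)\<^sup>2 + (cmod b)\<^sup>2) / 2)) + ((norm x0)\<^sup>2 + (norm y0)\<^sup>2) / 2"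
    using sum_squares_bound[of "cmod a" "cmod b"] sum_squares_bound[of "norm x0" "norm y0"] r \<open>0 \<le> c\<close>
    by (intro add_mono mult_left_mono) auto
  also have "\<dots> = 1 - (1 - c) * (A + B) / 2"
    unfolding nx ny by (simp add: A B field_simps)
  finally show "(1 - c) * ((cmod (ip g' x))\<^sup>2 / (1 - c\<^sup>2) + (cmod (ip h' y))\<^sup>2 / (1 - c\<^sup>2)) / 2
      \<le> 1 - cmod (ip x y)"
    unfolding A_def B_def r_def by linarith
qed

text \<open>
  The preceding bound is applied to \<open>f j\<close> and \<open>e j\<close> for all \<open>j \<noteq> k\<close>. By Parseval's identity the two
  squared components, normalized, each have sum 1 over \<open>j\<close>, so the defects
  at \<open>j \<noteq> k\<close> add up to at least \<open>1 - c\<close>. The defect at \<open>k\<close> itself is \<open>1 - c\<close>.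
\<close>

lemma onb_defect_le:
  assumes e: "onb e" and f: "onb f" and summable: "summable (\<lambda>j. 1 - cmod (ip (f j) (e j)))"
  shows "2 * (1 - cmod (ip (f k) (e k))) \<le> (\<Sum>j. 1 - cmod (ip (f j) (e j)))"
proof -
  define c where "c = cmod (ip (f k) (e k))"
  have norms: "norm (e j) = 1" "norm (f j) = 1" for j using e f onb_norm by blast+
  have nonneg: "0 \<le> 1 - cmod (ip (f j) (e j))" for j
    using cmod_ip_le[of "f j" "e j"] norms by simp
  show ?thesis
  proof (cases "c < 1")
    case False
    then have "2 * (1 - cmod (ip (f k) (e k))) \<le> 0" unfolding c_def by simp
    also have "0 \<le> (\<Sum>j. 1 - cmod (ip (f j) (e j)))" by (rule suminf_nonneg[OF summable nonneg])
    finally show ?thesis .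
  next
    case True
    define g' where "g' = e k - scale (ip (e k) (f k)) (f k)"
    define h' where "h' = f k - scale (ip (f k) (e k)) (e k)"
    define r where "r = 1 - c\<^sup>2"
    have "c\<^sup>2 < 1" using True by (simp add: c_def abs_square_less_1)
    then have r: "r > 0" by (simp add: r_def)
    note plane = cmod_ip_le_of_orthogonal[of "f k" "e k", folded c_def g'_def h'_def r_def]
    obtain i where "i \<noteq> k" using that[of "Suc k"] by simp
    then have g'h': "(norm g')\<^sup>2 = r" "(norm h')\<^sup>2 = r"
      using plane(1,2)[of "f i" "e i"] norms True onb_ip[OF e] onb_ip[OF f] by auto
    \<comment> \<open>At \<open>k\<close> the first summand vanishes, since \<open>g'\<close> and \<open>h'\<close> are orthogonal to \<open>f k\<close> and \<open>e k\<close>.\<close>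
    define low where "low j = (1 - c) * ((cmod (ip g' (f j)))\<^sup>2 / r + (cmod (ip h' (e j)))\<^sup>2 / r) / 2
      + (if j = k then 1 - c else 0)" for j
    have "low sums ((1 - c) * (r / r + r / r) / 2 + (1 - c))" (is "_ sums ?s")
      unfolding low_def using onb_expansion(2)[OF f, of g'] onb_expansion(2)[OF e, of h'] g'h'
      by (intro sums_add sums_divide sums_mult sums_single) simp_all
    moreover have "?s = 2 * (1 - c)" using r by (simp add: field_simps)
    ultimately have low: "low sums (2 * (1 - c))" by (simp only:)
    have "low j \<le> 1 - cmod (ip (f j) (e j))" for j
    proof (cases "j = k")
      case True
      have "ip g' (f k) = 0" "ip h' (e k) = 0"
        using onb_ip[OF e, of k k] onb_ip[OF f, of k k] ip_in_K
        by (simp_all add: g'_def h'_def ip_linear ip_scale)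
      then show ?thesis using True by (simp add: low_def c_def)
    next
      case False
      then show ?thesis
        using plane(3)[of "f j" "e j"] norms \<open>c < 1\<close> onb_ip[OF e] onb_ip[OF f]
        by (simp add: low_def)
    qed
    then have "suminf low \<le> (\<Sum>j. 1 - cmod (ip (f j) (e j)))"
      using low summable by (intro suminf_le) (auto simp: sums_iff)
    then show ?thesis using low by (simp add: sums_iff c_def)
  qed
qed

end

section \<open>Plane rotations and the polygon inequality\<close>

text \<open>
  The matrix \<open>diag(a, 1)\<close> splits as \<open>(1 + a)/2\<close> times the identity minus \<open>(1 - a)/2\<close> times the
  reflection \<open>diag(1, -1)\<close>. Rotating by independent angles on the two sides turns the first part
  by the difference and the second by the sum of the angles, so the sum and the difference
  of the diagonal entries can be adjusted independently.
\<close>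

lemma rotate_diagonal_pair:
  fixes a x y :: real
  assumes "\<bar>x + y\<bar> \<le> 1 + a" "\<bar>x - y\<bar> \<le> 1 - a"
  obtains c s c' s' where "c\<^sup>2 + s\<^sup>2 = 1" "c'\<^sup>2 + s'\<^sup>2 = 1"
    "a * (c * c') + s * s' = x" "a * (s * s') + c * c' = y"
proof -
  define \<sigma> where "\<sigma> = arccos ((x + y) / (1 + a))"
  define \<tau> where "\<tau> = arccos ((y - x) / (1 - a))"
  have sum: "(1 + a) * cos \<sigma> = x + y"
    using assms by (cases "1 + a = 0") (auto simp: \<sigma>_def abs_le_iff field_simps cos_arccos)
  have diff: "(1 - a) * cos \<tau> = y - x"
    using assms by (cases "1 - a = 0") (auto simp: \<tau>_def abs_le_iff field_simps cos_arccos)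
  define \<alpha> \<beta> where "\<alpha> = (\<tau> + \<sigma>) / 2" and "\<beta> = (\<tau> - \<sigma>) / 2"
  have "\<sigma> = \<alpha> - \<beta>" "\<tau> = \<alpha> + \<beta>" by (simp_all add: \<alpha>_def \<beta>_def field_simps)
  with sum diff have
    "(1 + a) * (cos \<alpha> * cos \<beta> + sin \<alpha> * sin \<beta>) = x + y"
    "(1 - a) * (cos \<alpha> * cos \<beta> - sin \<alpha> * sin \<beta>) = y - x"
    by (simp_all add: cos_diff cos_add)
  then have "a * (cos \<alpha> * cos \<beta>) + sin \<alpha> * sin \<beta> = x"
    "a * (sin \<alpha> * sin \<beta>) + cos \<alpha> * cos \<beta> = y"
    by (simp_all add: algebra_simps)
  then show ?thesis using that[of "cos \<alpha>" "sin \<alpha>" "cos \<beta>" "sin \<beta>"] by simp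
qed

definition rotate_pair ::
  "'i \<Rightarrow> 'i \<Rightarrow> real \<Rightarrow> real \<Rightarrow> ('i \<Rightarrow> 'a::real_vector) \<Rightarrow> 'i \<Rightarrow> 'a" where
  "rotate_pair p q c s e = e(p := c *\<^sub>R e p + s *\<^sub>R e q, q := c *\<^sub>R e q - s *\<^sub>R e p)"

lemma rotate_pair_simps:
  "p \<noteq> q \<Longrightarrow> rotate_pair p q c s e p = c *\<^sub>R e p + s *\<^sub>R e q"
  "rotate_pair p q c s e q = c *\<^sub>R e q - s *\<^sub>R e p"
  "i \<noteq> p \<Longrightarrow> i \<noteq> q \<Longrightarrow> rotate_pair p q c s e i = e i"
  by (simp_all add: rotate_pair_def)

lemma rotate_pair_inverse:
  assumes "p \<noteq> q" "c\<^sup>2 + s\<^sup>2 = 1"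
  shows "rotate_pair p q c (- s) (rotate_pair p q c s e) = e"
proof
  fix i
  have *: "(c * c) *\<^sub>R z + (s * s) *\<^sub>R z = z" for z :: 'b
    using assms(2) by (simp add: scaleR_add_left[symmetric] power2_eq_square)
  show "rotate_pair p q c (- s) (rotate_pair p q c s e) i = e i"
    using assms(1) *[of "e p"] *[of "e q"]
    by (cases "i = p"; cases "i = q") (simp_all add: rotate_pair_def algebra_simps)
qed

lemma span_rotate_pair:
  fixes I :: "'i set" and e :: "'i \<Rightarrow> 'a::real_vector"
  assumes "p \<noteq> q" "p \<in> I" "q \<in> I" "c\<^sup>2 + s\<^sup>2 = 1"
  shows "span (rotate_pair p q c s e ` I) = span (e ` I)"
proof -
  have sub: "rotate_pair p q c s e ` I \<subseteq> span (e ` I)" for c s and e :: "'i \<Rightarrow> 'a"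
    using assms(2,3)
    by (auto simp: rotate_pair_def intro!: span_add span_diff span_scale intro: span_base)
  have "e ` I \<subseteq> span (rotate_pair p q c s e ` I)"
    using sub[of c "- s" "rotate_pair p q c s e"] assms(1,4) by (simp add: rotate_pair_inverse)
  with sub[of c s e] show ?thesis by (simp add: span_eq)
qed

context hilbert_over
begin

lemma ip_eq_0_on_span:
  assumes "y \<in> span S" "\<And>x. x \<in> S \<Longrightarrow> ip x z = 0"
  shows "ip y z = 0"
  using assms by (induction rule: span_induct_alt) (auto simp: ip_linear)

lemma orthonormal_on_rotate_pair:
  assumes e: "orthonormal_on I e" and "p \<noteq> q" "p \<in> I" "q \<in> I" "c\<^sup>2 + s\<^sup>2 = 1"
  shows "orthonormal_on I (rotate_pair p q c s e)"
proof -
  have cs: "complex_of_real c * of_real c + of_real s * of_real s = 1"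
    using assms(5) by (simp add: power2_eq_square flip: of_real_mult of_real_add)
  show ?thesis
    unfolding orthonormal_on_def
  proof (intro ballI)
    fix i j assume ij: "i \<in> I" "j \<in> I"
    note [simp] = orthonormal_onD[OF e]
    show "ip (rotate_pair p q c s e i) (rotate_pair p q c s e j) = (if i = j then 1 else 0)"
      using ij assms cs
      by (cases "i = p"; cases "i = q"; cases "j = p"; cases "j = q")
        (auto simp: rotate_pair_simps ip_linear algebra_simps)
  qed
qed

text \<open>
  If \<open>t\<close>, \<open>\<delta> p\<close> and \<open>\<delta> q\<close> satisfy the triangle inequalities, then a pair of rotations turns
  the inner products \<open>1 - t, 1\<close> at the indices \<open>p, q\<close> into \<open>1 - \<delta> p, 1 - \<delta> q\<close>. Hence two sides
  \<open>\<delta> p\<close> and \<open>\<delta> q\<close> of a polygon may be replaced by one diagonal \<open>t\<close> of the polygon, and induction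
  on the number of sides applies. The spans must agree for blocks to be put together later.
\<close>

lemma polygon_block:
  assumes "finite I" "orthonormal_on I u" "\<And>i. i \<in> I \<Longrightarrow> 0 \<le> \<delta> i" "\<And>i. i \<in> I \<Longrightarrow> \<delta> i \<le> 1"
    "\<And>i. i \<in> I \<Longrightarrow> 2 * \<delta> i \<le> sum \<delta> I"
  shows "\<exists>e f. orthonormal_on I e \<and> orthonormal_on I f
    \<and> span (e ` I) = span (u ` I) \<and> span (f ` I) = span (u ` I)
    \<and> (\<forall>i\<in>I. ip (f i) (e i) = of_real (1 - \<delta> i))"
  using assms
proof (induction I arbitrary: \<delta> rule: finite_induct)
  case empty
  then show ?case by (auto simp: orthonormal_on_def)
next
  case (insert q I)
  show ?case
  proof (cases "I = {}")
    case True
    with insert.prems have "\<delta> q = 0" by force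
    with True insert.prems(1) show ?thesis
      by (intro exI[of _ u]) (auto simp: orthonormal_on_def)
  next
    case False
    then obtain p where p: "p \<in> I" by blast
    with insert.hyps have "p \<noteq> q" by blast
    define R where "R = sum \<delta> (I - {p})"
    \<comment> \<open>The longest diagonal not above 1 that closes both the triangle and the remaining polygon.\<close>
    define t where "t = min 1 (min (\<delta> p + \<delta> q) R)"
    have sumI: "sum \<delta> I = \<delta> p + R" using insert.hyps(1) p by (simp add: R_def sum.remove)
    then have total: "sum \<delta> (insert q I) = \<delta> q + \<delta> p + R" using insert.hyps by simp
    have \<delta>: "0 \<le> \<delta> i" "\<delta> i \<le> 1" if "i \<in> insert q I" for i using insert.prems that by auto
    have R: "0 \<le> R" unfolding R_def using \<delta> by (intro sum_nonneg) auto
    have pq: "\<bar>\<delta> p - \<delta> q\<bar> \<le> t"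
      using insert.prems(4)[of p] insert.prems(4)[of q] p total \<delta>[of p] \<delta>[of q] R
      unfolding t_def by (auto simp: abs_le_iff)
    have t: "0 \<le> t" "t \<le> 1" "t \<le> R" "t \<le> \<delta> p + \<delta> q"
      using R \<delta>[of p] \<delta>[of q] p by (auto simp: t_def)
    let ?\<delta> = "\<delta>(p := t)"
    have sum': "sum ?\<delta> I = t + R"
      using insert.hyps(1) p by (simp add: R_def sum.remove[of I p])
    have "2 * ?\<delta> i \<le> sum ?\<delta> I" if "i \<in> I" for i
    proof (cases "i = p")
      case True
      then show ?thesis using t unfolding sum' by simp
    next
      case False
      then have "\<delta> i \<le> R"
        unfolding R_def using that insert.hyps(1) \<delta> by (intro member_le_sum) auto
      moreover have "2 * \<delta> i \<le> \<delta> q + \<delta> p + R" using insert.prems(4)[of i] that total by simp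
      ultimately show ?thesis using False \<delta>[of i] that unfolding sum' by (simp add: t_def)
    qed
    moreover have "orthonormal_on I u" using insert.prems(1) by (rule orthonormal_on_subset) blast
    ultimately obtain e f where ef: "orthonormal_on I e" "orthonormal_on I f"
      "span (e ` I) = span (u ` I)" "span (f ` I) = span (u ` I)"
      "\<forall>i\<in>I. ip (f i) (e i) = of_real (1 - ?\<delta> i)"
      using insert.IH[of ?\<delta>] \<delta> t by fastforce
    have extend: "orthonormal_on (insert q I) (g(q := u q))"
      "span ((g(q := u q)) ` insert q I) = span (u ` insert q I)"
      "\<forall>i\<in>I. ip (u q) (g i) = 0" "\<forall>i\<in>I. ip (g i) (u q) = 0"
      if g: "orthonormal_on I g" "span (g ` I) = span (u ` I)" for g
    proof -
      have "g i \<in> span (u ` I)" if "i \<in> I" for i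
        using g(2) that span_base[of "g i" "g ` I"] by blast
      then show right: "\<forall>i\<in>I. ip (g i) (u q) = 0"
      proof (intro ballI, rule ip_eq_0_on_span)
        show "ip x (u q) = 0" if "x \<in> u ` I" for x
          using that orthonormal_onD[OF insert.prems(1)] insert.hyps(2) by fastforce
      qed
      then show left: "\<forall>i\<in>I. ip (u q) (g i) = 0" using ip_commute[of "u q"] by simp
      show "orthonormal_on (insert q I) (g(q := u q))"
        using g(1) left right insert.hyps(2) orthonormal_onD[OF insert.prems(1), of q q]
        by (auto simp: orthonormal_on_def)
      have "(g(q := u q)) ` insert q I = insert (u q) (g ` I)"
        using insert.hyps(2) by (auto simp: image_iff)
      then show "span ((g(q := u q)) ` insert q I) = span (u ` insert q I)"
        using g(2) by (simp only: span_insert image_insert)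
    qed
    note e = extend[OF ef(1,3)] and f = extend[OF ef(2,4)]
    have "\<bar>(1 - \<delta> p) + (1 - \<delta> q)\<bar> \<le> 1 + (1 - t)" "\<bar>(1 - \<delta> p) - (1 - \<delta> q)\<bar> \<le> 1 - (1 - t)"
      using pq t \<delta>[of p] \<delta>[of q] p by auto
    then obtain c s c' s' where cs: "c\<^sup>2 + s\<^sup>2 = 1" "c'\<^sup>2 + s'\<^sup>2 = 1"
      "(1 - t) * (c * c') + s * s' = 1 - \<delta> p" "(1 - t) * (s * s') + c * c' = 1 - \<delta> q"
      by (rule rotate_diagonal_pair)
    let ?e = "rotate_pair p q c s (e(q := u q))" and ?f = "rotate_pair p q c' s' (f(q := u q))"
    have ip_pq: "ip (f p) (e p) = of_real (1 - t)" "ip (u q) (u q) = 1"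
      "ip (f p) (u q) = 0" "ip (u q) (e p) = 0"
      using ef(5) p e(3) f(4) orthonormal_onD[OF insert.prems(1), of q q] by auto
    have "ip (?f i) (?e i) = of_real (1 - \<delta> i)" if i: "i \<in> insert q I" for i
    proof -
      consider "i = p" | "i = q" | "i \<in> I" "i \<noteq> p" "i \<noteq> q" using i by blast
      then show ?thesis
      proof cases
        case 1
        show ?thesis
          unfolding 1 cs(3)[symmetric]
          using \<open>p \<noteq> q\<close> by (simp add: rotate_pair_simps ip_linear ip_pq algebra_simps)
      next
        case 2
        show ?thesis
          unfolding 2 cs(4)[symmetric]
          using \<open>p \<noteq> q\<close> by (simp add: rotate_pair_simps ip_linear ip_pq algebra_simps)
      next
        case 3
        then show ?thesis using ef(5) by (simp add: rotate_pair_simps)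
      qed
    qed
    moreover have "orthonormal_on (insert q I) ?e" "orthonormal_on (insert q I) ?f"
      using \<open>p \<noteq> q\<close> p cs(1,2) e(1) f(1) by (simp_all add: orthonormal_on_rotate_pair)
    moreover have "span (?e ` insert q I) = span (u ` insert q I)"
      unfolding e(2)[symmetric] using \<open>p \<noteq> q\<close> p cs(1) by (intro span_rotate_pair) auto
    moreover have "span (?f ` insert q I) = span (u ` insert q I)"
      unfolding f(2)[symmetric] using \<open>p \<noteq> q\<close> p cs(2) by (intro span_rotate_pair) auto
    ultimately show ?thesis by blast
  qed
qed

end

section \<open>Constructing bases with prescribed mutual inner products\<close>

text \<open>
  The partial sums of the series rise in steps of at most 1. The blocks below are the stretches
  of indices on which they stay inside one of the intervals from \<open>3 * n\<close> to \<open>3 * n + 3\<close>.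
\<close>

lemma divergent_series_blocks:
  fixes \<delta> :: "nat \<Rightarrow> real"
  assumes \<delta>: "\<And>j. 0 \<le> \<delta> j" "\<And>j. \<delta> j \<le> 1" and diverges: "\<not> summable \<delta>"
  obtains k :: "nat \<Rightarrow> nat" where "\<And>n. finite {j. k j = n}" "\<And>n. 2 \<le> sum \<delta> {j. k j = n}"
proof -
  define P where "P j = sum \<delta> {..<j}" for j
  define k where "k j = nat \<lfloor>P j / 3\<rfloor>" for j
  have mono: "P i \<le> P j" if "i \<le> j" for i j
    unfolding P_def using that \<delta> by (intro sum_mono2) auto
  have unbounded: "\<exists>j. P j \<ge> M" for M
  proof (rule ccontr)
    assume "\<nexists>j. P j \<ge> M"
    then have "P (Suc n) \<le> M" for n by (meson linear)
    then have "sum \<delta> {..n} \<le> M" for n by (simp only: P_def lessThan_Suc_atMost)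
    then show False using diverges \<delta>(1) bounded_imp_summable by blast
  qed
  define a where "a n = (LEAST j. P j \<ge> 3 * real n)" for n
  have a: "P (a n) \<ge> 3 * real n" for n
    unfolding a_def using LeastI_ex[OF unbounded] .
  have before_a: "P j < 3 * real n" if "j < a n" for j n
    using not_less_Least[of j "\<lambda>j. P j \<ge> 3 * real n"] that by (simp add: a_def)
  have a_less: "P (a n) < 3 * real n + 1" for n
  proof (cases "a n")
    case 0
    then show ?thesis by (simp add: P_def)
  next
    case (Suc j)
    then show ?thesis using before_a[of j n] \<delta>(2)[of j] by (simp add: P_def)
  qed
  have block: "{j. k j = n} = {a n..<a (Suc n)}" for n
  proof -
    have "k j = n \<longleftrightarrow> 3 * real n \<le> P j \<and> P j < 3 * real (Suc n)" for j
    proof -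
      have "0 \<le> P j" unfolding P_def using \<delta> by (intro sum_nonneg) auto
      then have "k j = n \<longleftrightarrow> \<lfloor>P j / 3\<rfloor> = int n" unfolding k_def by (auto simp: nat_eq_iff)
      also have "\<dots> \<longleftrightarrow> 3 * real n \<le> P j \<and> P j < 3 * real (Suc n)"
        unfolding floor_eq_iff by (auto simp: field_simps)
      finally show ?thesis .
    qed
    moreover have "3 * real m \<le> P j \<longleftrightarrow> a m \<le> j" for m j
      using before_a[of j m] a[of m] mono[of "a m" j] by (meson le_less_linear not_le order_trans)
    ultimately show ?thesis by (auto simp flip: not_le simp del: of_nat_Suc)
  qed
  have "2 \<le> sum \<delta> {j. k j = n}" for n
  proof -
    have "a n \<le> a (Suc n)"
      using before_a[of "a (Suc n)" n] a[of "Suc n"] by (fastforce simp: not_less)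
    then have "sum \<delta> {a n..<a (Suc n)} = P (a (Suc n)) - P (a n)"
      using sum_diff_nat_ivl[of 0 "a n" "a (Suc n)" \<delta>] by (simp add: P_def atLeast0LessThan)
    then show ?thesis using a[of "Suc n"] a_less[of n] by (simp add: block)
  qed
  moreover have "finite {j. k j = n}" for n unfolding block by simp
  ultimately show ?thesis using that by blast
qed

context hilbert_over
begin

text \<open>Completeness is inherited blockwise: every \<open>u i\<close> is a linear combination of the new vectors
  in its block.\<close>

lemma onb_blocks:
  assumes u: "onb u"
    and e: "\<And>n. orthonormal_on {j. k j = n} (e n)"
    and span: "\<And>n. span (e n ` {j. k j = n}) = span (u ` {j. k j = n})"
  shows "onb (\<lambda>j. e (k j) j)"
proof -
  let ?B = "\<lambda>n. {j. k j = n}"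
  have orth: "ip (e (k i) i) (e (k j) j) = (if i = j then 1 else 0)" for i j
  proof (cases "k i = k j")
    case True
    then show ?thesis using orthonormal_onD[OF e, of i "k i" j] by simp
  next
    case False
    have "ip x y = 0" if "x \<in> span (u ` ?B (k i))" "y \<in> span (u ` ?B (k j))" for x y
    proof (rule ip_eq_0_on_span[OF that(1)])
      fix x' assume "x' \<in> u ` ?B (k i)"
      then have "ip y x' = 0"
        using False onb_ip[OF u] by (intro ip_eq_0_on_span[OF that(2)]) auto
      then show "ip x' y = 0" using ip_commute[of x' y] by simp
    qed
    moreover have "e (k i) i \<in> span (u ` ?B (k i))" for i
      unfolding span[symmetric] by (rule span_base) simp
    ultimately show ?thesis using False by auto
  qed
  have "x = 0" if x: "\<And>j. ip x (e (k j) j) = 0" for x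
  proof (rule onb_total[OF u])
    fix i
    have "u i \<in> span (e (k i) ` ?B (k i))" unfolding span by (rule span_base) simp
    then have "ip (u i) x = 0"
    proof (rule ip_eq_0_on_span)
      fix y assume "y \<in> e (k i) ` ?B (k i)"
      then show "ip y x = 0"
        using x ip_commute[of y x] by (metis (mono_tags) complex_cnj_zero imageE mem_Collect_eq)
    qed
    then show "ip x (u i) = 0" using ip_commute[of x] by simp
  qed
  with orth show ?thesis unfolding onb_def orthonormal_on_def by blast
qed

lemma polygon_blocks:
  assumes u: "onb u" and finite: "\<And>n. finite {j. k j = n}"
    and \<delta>: "\<And>j. 0 \<le> \<delta> j" "\<And>j. \<delta> j \<le> 1"
    and polygon: "\<And>i. 2 * \<delta> i \<le> sum \<delta> {j. k j = k i}"
  obtains e f where "onb e" "onb f" "\<And>j. ip (f j) (e j) = of_real (1 - \<delta> j)"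
proof -
  have u': "orthonormal_on A u" for A
    using u orthonormal_on_subset unfolding onb_def by blast
  have "\<forall>n. \<exists>e f. orthonormal_on {j. k j = n} e \<and> orthonormal_on {j. k j = n} f
    \<and> span (e ` {j. k j = n}) = span (u ` {j. k j = n})
    \<and> span (f ` {j. k j = n}) = span (u ` {j. k j = n})
    \<and> (\<forall>i\<in>{j. k j = n}. ip (f i) (e i) = of_real (1 - \<delta> i))"
    using polygon by (intro allI polygon_block finite u' \<delta>) auto
  then obtain e f where ef: "\<And>n. orthonormal_on {j. k j = n} (e n)"
    "\<And>n. orthonormal_on {j. k j = n} (f n)"
    "\<And>n. span (e n ` {j. k j = n}) = span (u ` {j. k j = n})"
    "\<And>n. span (f n ` {j. k j = n}) = span (u ` {j. k j = n})"
    "\<And>n. \<forall>i\<in>{j. k j = n}. ip (f n i) (e n i) = of_real (1 - \<delta> i)"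
    by metis
  show ?thesis
  proof (rule that)
    show "onb (\<lambda>j. e (k j) j)" "onb (\<lambda>j. f (k j) j)"
      using onb_blocks[OF u] ef by blast+
    show "ip (f (k j) j) (e (k j) j) = of_real (1 - \<delta> j)" for j using ef(5) by simp
  qed
qed

text \<open>The vectors below are the images of the \<open>e j\<close> under the reflection in the hyperplane
  orthogonal to \<open>v\<close>, which is unitary and its own inverse.\<close>

lemma onb_reflect:
  assumes e: "onb e" and v: "\<And>j. ip v (e j) = of_real (\<kappa> j)" "ip v v = 1"
  shows "onb (\<lambda>j. e j - (2 * \<kappa> j) *\<^sub>R v)"
proof -
  have v': "ip (e j) v = of_real (\<kappa> j)" for j using v(1) ip_commute[of "e j"] by simp
  have "orthonormal_on UNIV (\<lambda>j. e j - (2 * \<kappa> j) *\<^sub>R v)"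
    unfolding orthonormal_on_def using onb_ip[OF e] v v' by (auto simp: ip_linear)
  moreover have "x = 0" if x: "\<And>j. ip x (e j - (2 * \<kappa> j) *\<^sub>R v) = 0" for x
  proof -
    have K: "2 * ip x v \<in> K" using K_mult[OF K_real[of 2] ip_in_K] by simp
    have "x - scale (2 * ip x v) v = 0"
    proof (rule onb_total[OF e])
      show "ip (x - scale (2 * ip x v) v) (e j) = 0" for j
        using x[of j] K v by (simp add: ip_linear ip_scale)
    qed
    then have x_eq: "x = scale (2 * ip x v) v" by simp
    then have "ip x v = 2 * ip x v" using ip_scale[OF K, of v v] v(2) by simp
    then have "ip x v = 0" by simp
    then show "x = 0" using x_eq scale_of_real[of 0 v] by simp
  qed
  ultimately show ?thesis unfolding onb_def by blast
qed

text \<open>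
  For indices in \<open>insert i J\<close> the matrix of the inner products of \<open>f\<close> with \<open>e\<close> is diagonal with entry
  \<open>1 - t\<close> at \<open>i\<close> and \<open>1\<close> elsewhere: the identity minus \<open>t\<close> times a projection of rank one.
  It is conjugated with a reflection, that is, \<open>e\<close> and \<open>f\<close> are reflected in vectors with the same
  coordinates \<open>\<kappa>\<close>. If the reflection takes the \<open>i\<close>-th coordinate vector to a unit vector \<open>p\<close>, then
  the diagonal of the result is \<open>1 - t * (p j)\<^sup>2\<close>, so \<open>p j = \<plusminus> sqrt (\<beta> j / t)\<close> is wanted. The vector
  defining the reflection is proportional to the difference of the \<open>i\<close>-th coordinate vector and \<open>p\<close>.
  Since \<open>p i\<close> is chosen negative or zero, this difference never vanishes.
\<close>

lemma split_defect:
  assumes e: "onb e" and f: "onb f" and i: "i \<notin> J" and J: "\<And>j. j \<in> J \<Longrightarrow> f j = e j"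
    and fi: "ip (f i) (e i) = of_real (1 - t)" and t: "t > 0"
    and \<beta>: "\<And>j. 0 \<le> \<beta> j" "\<And>j. j \<notin> insert i J \<Longrightarrow> \<beta> j = 0" "\<beta> sums t"
  obtains e' f' where "onb e'" "onb f'"
    "\<And>j. j \<in> insert i J \<Longrightarrow> ip (f' j) (e' j) = of_real (1 - \<beta> j)"
    "\<And>j. j \<notin> insert i J \<Longrightarrow> e' j = e j \<and> f' j = f j"
proof -
  define q where "q = sqrt (\<beta> i / t)"
  define c where "c = sqrt ((1 + q) / 2)"
  define \<gamma> where "\<gamma> j = (if j \<in> J then sqrt (\<beta> j / t) / (2 * c) else 0)" for j
  define \<kappa> where "\<kappa> = \<gamma>(i := c)"
  have q: "q \<ge> 0" "t * q\<^sup>2 = \<beta> i" using \<beta>(1)[of i] t by (auto simp: q_def)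
  then have c: "c > 0" "2 * c\<^sup>2 = 1 + q" by (auto simp: c_def)
  have \<gamma>: "4 * t * c\<^sup>2 * (\<gamma> j)\<^sup>2 = \<beta> j" if "j \<in> J" for j
    using that \<beta>(1)[of j] t c(1) by (simp add: \<gamma>_def power_divide power_mult_distrib)
  have "(\<lambda>j. \<beta> j - (if j = i then \<beta> j else 0)) sums (t - \<beta> i)"
    using \<beta>(3) sums_single[of i \<beta>] by (rule sums_diff)
  then have "(\<lambda>j. (\<beta> j - (if j = i then \<beta> j else 0)) / (4 * t * c\<^sup>2))
      sums ((t - \<beta> i) / (4 * t * c\<^sup>2))"
    by (rule sums_divide)
  moreover have "(\<beta> j - (if j = i then \<beta> j else 0)) / (4 * t * c\<^sup>2) = (\<gamma> j)\<^sup>2" for j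
  proof (cases "j \<in> J")
    case True
    then show ?thesis using \<gamma>[OF True, symmetric] i t c(1) by auto
  next
    case False
    then show ?thesis using \<beta>(2)[of j] by (auto simp: \<gamma>_def)
  qed
  moreover have "(t - \<beta> i) / (4 * t * c\<^sup>2) = 1 - c\<^sup>2"
  proof -
    have "4 * t * c\<^sup>2 * (1 - c\<^sup>2) = t * ((2 * c\<^sup>2) * (2 - 2 * c\<^sup>2))" by (simp add: algebra_simps)
    also have "\<dots> = t * ((1 + q) * (1 - q))" unfolding c(2) by simp
    also have "\<dots> = t - \<beta> i"
      unfolding q(2)[symmetric] by (simp add: algebra_simps power2_eq_square)
    finally show ?thesis using t c(1) by (simp add: field_simps)
  qed
  ultimately have \<gamma>_sums: "(\<lambda>j. (\<gamma> j)\<^sup>2) sums (1 - c\<^sup>2)" by simp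
  obtain w where w: "(\<lambda>n. \<Sum>j<n. scale (of_real (\<gamma> j)) (e j)) \<longlonglongrightarrow> w"
    "\<And>j. ip w (e j) = of_real (\<gamma> j)" "(norm w)\<^sup>2 = 1 - c\<^sup>2"
    using orthonormal_series[of e "\<lambda>j. of_real (\<gamma> j)"] e K_real \<gamma>_sums
    by (auto simp: onb_def sums_iff)
  \<comment> \<open>The partial sums involve only indices in \<open>J\<close>, where \<open>e\<close> and \<open>f\<close> agree.\<close>
  have wf: "ip w (f j) = of_real (\<gamma> j)" for j
  proof (rule LIMSEQ_unique)
    show "(\<lambda>n. ip (\<Sum>j<n. scale (of_real (\<gamma> j)) (e j)) (f j)) \<longlonglongrightarrow> ip w (f j)"
      using w(1) by (rule tendsto_ip)
    have "ip (\<Sum>j<n. scale (of_real (\<gamma> j)) (e j)) (f j) = of_real (\<gamma> j)" if "n > j" for n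
    proof -
      have "(\<Sum>j<n. scale (of_real (\<gamma> j)) (e j)) = (\<Sum>j<n. scale (of_real (\<gamma> j)) (f j))"
        using J by (intro sum.cong) (auto simp: \<gamma>_def scale_of_real)
      then show ?thesis
        using ip_orthonormal_sum[of "{..<n}" UNIV f j "\<lambda>j. of_real (\<gamma> j)"] f K_real that
        by (simp add: onb_def)
    qed
    then show "(\<lambda>n. ip (\<Sum>j<n. scale (of_real (\<gamma> j)) (e j)) (f j)) \<longlonglongrightarrow> of_real (\<gamma> j)"
      by (intro tendsto_eventually) (use eventually_gt_at_top[of j] in eventually_elim, blast)
  qed
  define v where "v g = c *\<^sub>R g i + w" for g
  have ww: "ip w w = of_real (1 - c\<^sup>2)" using w(3) by (simp only: ip_self)
  have \<gamma>i: "\<gamma> i = 0" using i by (simp add: \<gamma>_def)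
  have wc: "ip (e j) w = of_real (\<gamma> j)" "ip (f j) w = of_real (\<gamma> j)" for j
    using w(2)[of j] wf[of j] ip_commute[of _ w] by simp_all
  have v: "ip (v e) (e j) = of_real (\<kappa> j)" "ip (v e) (v e) = 1"
    "ip (v f) (f j) = of_real (\<kappa> j)" "ip (v f) (v f) = 1" for j
    using w(2) wf ww wc \<gamma>i onb_ip[OF e] onb_ip[OF f]
    by (auto simp: v_def \<kappa>_def ip_linear power2_eq_square)
  let ?e = "\<lambda>j. e j - (2 * \<kappa> j) *\<^sub>R v e" and ?f = "\<lambda>j. f j - (2 * \<kappa> j) *\<^sub>R v f"
  have vv: "ip (v f) (v e) = of_real (1 - t * c\<^sup>2)"
    by (simp add: w(2) wc ww \<gamma>i fi v_def ip_linear power2_eq_square algebra_simps)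
  have diag: "ip (?f j) (?e j) = of_real (1 - \<beta> j)" if j: "j \<in> insert i J" for j
  proof (cases "j = i")
    case True
    have 1: "ip (f i) (v e) = of_real (c * (1 - t))" "ip (v f) (e i) = of_real (c * (1 - t))"
      by (simp_all add: w(2) wc \<gamma>i fi v_def ip_linear)
    have "ip (?f i) (?e i)
        = of_real (1 - t - 2 * c * (c * (1 - t)) - 2 * c * (c * (1 - t)) + 4 * c\<^sup>2 * (1 - t * c\<^sup>2))"
      by (simp add: fi 1 vv \<kappa>_def ip_linear power2_eq_square algebra_simps)
    also have "1 - t - 2 * c * (c * (1 - t)) - 2 * c * (c * (1 - t)) + 4 * c\<^sup>2 * (1 - t * c\<^sup>2)
        = 1 - t * (2 * c\<^sup>2 - 1)\<^sup>2"
      by (simp add: power2_eq_square algebra_simps)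
    also have "\<dots> = 1 - \<beta> i" using c(2) q(2) by simp
    finally show ?thesis using True by simp
  next
    case False
    then have jJ: "j \<in> J" using j by blast
    then have 1: "ip (f j) (v e) = of_real (\<gamma> j)" "ip (v f) (e j) = of_real (\<gamma> j)"
      "ip (f j) (e j) = 1"
      using w(2)[of j] wc(2)[of j] False onb_ip[OF e, of j i] onb_ip[OF e, of j j]
        onb_ip[OF f, of i j] J[OF jJ]
      by (simp_all add: v_def ip_linear)
    have "ip (?f j) (?e j) = of_real (1 - 4 * t * c\<^sup>2 * (\<gamma> j)\<^sup>2)"
      using False by (simp add: 1 vv \<kappa>_def ip_linear power2_eq_square algebra_simps)
    then show ?thesis using \<gamma>[OF jJ] by simp
  qed
  show ?thesis
  proof (rule that)
    show "onb ?e" "onb ?f" using onb_reflect e f v by blast+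
    show "ip (?f j) (?e j) = of_real (1 - \<beta> j)" if "j \<in> insert i J" for j using diag that .
    show "?e j = e j \<and> ?f j = f j" if "j \<notin> insert i J" for j
      using that by (auto simp: \<kappa>_def \<gamma>_def)
  qed
qed

lemma onb_eq_if_ip_eq_1:
  assumes "onb e" "onb f" "ip (f j) (e j) = 1"
  shows "f j = e j"
proof -
  have "ip (f j - e j) (f j - e j) = 0"
    using assms onb_ip[of e j j] onb_ip[of f j j] ip_commute[of "e j" "f j"]
    by (simp add: ip_linear)
  then show ?thesis by (simp add: ip_self)
qed

text \<open>
  A summable sequence has a tail whose sum is below some \<open>\<delta> m\<close>. Such a tail can be
  collected into a single side of a finite polygon and split up again afterwards.
\<close>

lemma exists_onbs_summable:
  assumes u: "onb u" and \<delta>: "\<And>j. 0 \<le> \<delta> j" "\<And>j. \<delta> j \<le> 1"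
    and summable: "summable \<delta>" and polygon: "\<And>k. 2 * \<delta> k \<le> suminf \<delta>"
  obtains e f where "onb e" "onb f" "\<And>j. ip (f j) (e j) = of_real (1 - \<delta> j)"
proof (cases "\<forall>j. \<delta> j = 0")
  case True
  then show ?thesis using that[OF u u] onb_ip[OF u] by simp
next
  case False
  then obtain m where m: "\<delta> m > 0" using \<delta>(1) by (metis less_eq_real_def)
  obtain N0 where N0: "\<And>n. n \<ge> N0 \<Longrightarrow> norm (\<Sum>i. \<delta> (i + n)) < \<delta> m"
    using suminf_exist_split[OF m summable] by blast
  define N where "N = max N0 (Suc m)"
  define T where "T = (\<Sum>i. \<delta> (i + N))"
  have summableN: "summable (\<lambda>i. \<delta> (i + N))" using summable by (rule summable_ignore_initial_segment)
  have T: "0 \<le> T" "T \<le> \<delta> m" "m < N"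
    using N0[of N] \<delta>(1) summableN by (auto simp: T_def N_def intro: suminf_nonneg)
  have suminf: "suminf \<delta> = T + (\<Sum>j<N. \<delta> j)"
    unfolding T_def by (rule suminf_split_initial_segment[OF summable])
  define \<delta>' where "\<delta>' j = (if j < N then \<delta> j else if j = N then T else 0)" for j
  define k where "k j = (if j \<le> N then 0 else j)" for j
  have block: "{j. k j = n} = (if n = 0 then {..N} else if n \<le> N then {} else {n})" for n
    by (auto simp: k_def)
  have "sum \<delta>' {..N} = suminf \<delta>"
    by (simp add: lessThan_Suc_atMost[symmetric] suminf \<delta>'_def)
  moreover have "2 * \<delta>' i \<le> suminf \<delta>" if "i \<le> N" for i
  proof (cases "i = N")
    case True
    have "\<delta> m \<le> (\<Sum>j<N. \<delta> j)" using T(3) \<delta>(1) by (intro member_le_sum) auto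
    then show ?thesis using True T suminf by (simp add: \<delta>'_def)
  next
    case False
    then show ?thesis using polygon that by (simp add: \<delta>'_def)
  qed
  ultimately have "2 * \<delta>' i \<le> sum \<delta>' {j. k j = k i}" for i
    unfolding block by (cases "i \<le> N") (auto simp: k_def, auto simp: \<delta>'_def)
  moreover have "0 \<le> \<delta>' j" "\<delta>' j \<le> 1" for j
    using \<delta>[of j] \<delta>(2)[of m] T by (auto simp: \<delta>'_def)
  moreover have "finite {j. k j = n}" for n unfolding block by simp
  ultimately obtain e f where ef: "onb e" "onb f" "\<And>j. ip (f j) (e j) = of_real (1 - \<delta>' j)"
    using polygon_blocks[OF u, of k \<delta>'] by blast
  show ?thesis
  proof (cases "T = 0")
    case True
    then have "\<delta> (i + N) = 0" for i
      using suminf_eq_zero_iff[OF summableN] \<delta>(1) unfolding T_def by blast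
    then have "\<delta> j = 0" if "j \<ge> N" for j using that by (metis le_add_diff_inverse2)
    then have "\<delta>' j = \<delta> j" for j using True by (simp add: \<delta>'_def)
    then show ?thesis using that ef by metis
  next
    case False
    define \<beta> where "\<beta> j = (if j < N then 0 else \<delta> j)" for j
    have "(\<lambda>i. \<beta> (i + N)) sums T"
      unfolding T_def \<beta>_def using summableN by (simp add: summable_sums)
    then have "\<beta> sums T" unfolding sums_iff_shift by (simp add: \<beta>_def)
    moreover have "f j = e j" if "j \<in> {N<..}" for j
      using onb_eq_if_ip_eq_1[OF ef(1,2)] ef(3)[of j] that by (simp add: \<delta>'_def)
    moreover have "ip (f N) (e N) = of_real (1 - T)" using ef(3)[of N] by (simp add: \<delta>'_def)
    moreover have "T > 0" "0 \<le> \<beta> j" "j \<notin> insert N {N<..} \<Longrightarrow> \<beta> j = 0" for j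
      using False T(1) \<delta>(1) by (auto simp: \<beta>_def)
    ultimately obtain e' f' where e'f': "onb e'" "onb f'"
      "\<And>j. j \<in> insert N {N<..} \<Longrightarrow> ip (f' j) (e' j) = of_real (1 - \<beta> j)"
      "\<And>j. j \<notin> insert N {N<..} \<Longrightarrow> e' j = e j \<and> f' j = f j"
      using split_defect[OF ef(1,2), of N "{N<..}" T \<beta>] by blast
    have "ip (f' j) (e' j) = of_real (1 - \<delta> j)" for j
      using e'f'(3)[of j] e'f'(4)[of j] ef(3)[of j] nat_neq_iff[of j N]
      by (cases "j < N") (auto simp: \<beta>_def \<delta>'_def)
    with e'f' show ?thesis using that by blast
  qed
qed

text \<open>The two preceding constructions yield the moduli, and scalars of modulus 1 applied to \<open>f\<close>
  adjust the arguments. A divergent sum of defects imposes no condition: blocks of sum at least 2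
  satisfy the polygon inequality because the defects are at most 1.\<close>

lemma exists_onbs:
  assumes u: "onb u" and d: "\<And>j. d j \<in> K" "\<And>j. cmod (d j) \<le> 1"
    and polygon: "summable (\<lambda>j. 1 - cmod (d j)) \<Longrightarrow>
      (\<And>k. 2 * (1 - cmod (d k)) \<le> (\<Sum>j. 1 - cmod (d j)))"
  obtains e f where "onb e" "onb f" "\<And>j. ip (f j) (e j) = d j"
proof -
  let ?\<delta> = "\<lambda>j. 1 - cmod (d j)"
  have \<delta>: "0 \<le> ?\<delta> j" "?\<delta> j \<le> 1" for j using d(2) by auto
  obtain e f where ef: "onb e" "onb f" "\<And>j. ip (f j) (e j) = of_real (1 - ?\<delta> j)"
  proof (cases "summable ?\<delta>")
    case True
    then show ?thesis using exists_onbs_summable[OF u \<delta> True polygon] that by blast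
  next
    case False
    then obtain k :: "nat \<Rightarrow> nat" where
      k: "\<And>n. finite {j. k j = n}" "\<And>n. 2 \<le> sum ?\<delta> {j. k j = n}"
      using divergent_series_blocks[of ?\<delta>] \<delta> by blast
    have "2 * ?\<delta> i \<le> sum ?\<delta> {j. k j = k i}" for i
      by (rule order_trans[OF _ k(2)]) (use \<delta>(2)[of i] in simp)
    then show ?thesis using polygon_blocks[of u k ?\<delta>] u k(1) \<delta> that by blast
  qed
  have "\<forall>j. \<exists>w. w \<in> K \<and> cmod w = 1 \<and> d j = w * of_real (cmod (d j))"
    using unimodular_factor[OF d(1)] by blast
  then obtain w where w: "\<And>j. w j \<in> K" "\<And>j. cmod (w j) = 1"
    "\<And>j. d j = w j * of_real (cmod (d j))"
    by metis
  let ?f = "\<lambda>j. scale (w j) (f j)"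
  have "orthonormal_on UNIV ?f"
    unfolding orthonormal_on_def
    using onb_ip[OF ef(2)] w complex_norm_square[of "w _"]
    by (auto simp: ip_scale ip_scale_right mult.commute)
  moreover have "x = 0" if "\<And>j. ip x (?f j) = 0" for x
  proof (rule onb_total[OF ef(2)])
    fix j
    have "w j \<noteq> 0" using w(2)[of j] by auto
    then show "ip x (f j) = 0" using that[of j] w(1) by (simp add: ip_scale_right)
  qed
  ultimately have "onb ?f" unfolding onb_def by blast
  moreover have "ip (?f j) (e j) = d j" for j
    using ef(3)[of j] w(1,3) by (simp add: ip_scale)
  ultimately show ?thesis using that ef(1) by blast
qed

end

section \<open>Diagonals as inner products of two bases\<close>

text \<open>If the series converges, its sum bounds \<open>2 * (1 - c k)\<close> for all \<open>k\<close> exactly if it bounds the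
  supremum of these numbers, attained or not. If it diverges, the right-hand side is infinite.\<close>

lemma ereal_defect_condition_iff:
  fixes c :: "nat \<Rightarrow> real"
  assumes c: "\<And>j. 0 \<le> c j" "\<And>j. c j \<le> 1"
  shows "ereal (2 * (1 - (INF j. c j))) \<le> (\<Sum>j. ereal (1 - c j)) \<longleftrightarrow>
    (summable (\<lambda>j. 1 - c j) \<longrightarrow> (\<forall>k. 2 * (1 - c k) \<le> (\<Sum>j. 1 - c j)))"
proof (cases "summable (\<lambda>j. 1 - c j)")
  case False
  have "(\<Sum>j. ereal (1 - c j)) = \<infinity>"
  proof (rule ccontr)
    assume "(\<Sum>j. ereal (1 - c j)) \<noteq> \<infinity>"
    then show False using False summable_real_of_ereal[of "\<lambda>j. ereal (1 - c j)"] c(2) by simp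
  qed
  with False show ?thesis by simp
next
  case True
  let ?S = "\<Sum>j. 1 - c j"
  have bdd: "bdd_below (range c)" using c(1) by (intro bdd_belowI2[of _ 0]) auto
  have "2 * (1 - (INF j. c j)) \<le> ?S \<longleftrightarrow> (\<forall>k. 2 * (1 - c k) \<le> ?S)"
  proof
    assume "2 * (1 - (INF j. c j)) \<le> ?S"
    moreover have "(INF j. c j) \<le> c k" for k using bdd by (intro cINF_lower) auto
    then have "2 * (1 - c k) \<le> 2 * (1 - (INF j. c j))" for k by simp
    ultimately show "\<forall>k. 2 * (1 - c k) \<le> ?S" by (meson order_trans)
  next
    assume *: "\<forall>k. 2 * (1 - c k) \<le> ?S"
    have "1 - s / 2 \<le> (INF j. c j)" if "\<forall>k. 2 * (1 - c k) \<le> s" for s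
      using that by (intro cINF_greatest) (auto simp: field_simps)
    from this[OF *] show "2 * (1 - (INF j. c j)) \<le> ?S" by (simp add: field_simps)
  qed
  with True show ?thesis by (simp add: suminf_ereal')
qed

context hilbert_over
begin

theorem exists_onb_pair_iff:
  assumes separable: "separable_space (euclidean :: 'a topology)"
    and infinite_dim: "\<And>B. finite B \<Longrightarrow> orthonormal_on B id \<Longrightarrow>
      \<exists>x. x \<noteq> (\<Sum>b\<in>B. scale (ip x b) b)"
    and d: "\<And>j. d j \<in> K"
  shows "(\<exists>e f. onb e \<and> onb f \<and> (\<forall>j. ip (f j) (e j) = d j)) \<longleftrightarrow>
    (\<forall>j. cmod (d j) \<le> 1) \<and>
    ereal (2 * (1 - (INF j. cmod (d j)))) \<le> (\<Sum>j. ereal (1 - cmod (d j)))"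
proof
  assume "\<exists>e f. onb e \<and> onb f \<and> (\<forall>j. ip (f j) (e j) = d j)"
  then obtain e f where ef: "onb e" "onb f" "\<And>j. d j = ip (f j) (e j)" by metis
  have le1: "cmod (d j) \<le> 1" for j
    using cmod_ip_le[of "f j" "e j"] onb_norm ef by simp
  moreover have "summable (\<lambda>j. 1 - cmod (d j)) \<longrightarrow> (\<forall>k. 2 * (1 - cmod (d k)) \<le> (\<Sum>j. 1 - cmod (d j)))"
    using onb_defect_le[OF ef(1,2)] unfolding ef(3) by blast
  ultimately show "(\<forall>j. cmod (d j) \<le> 1) \<and>
    ereal (2 * (1 - (INF j. cmod (d j)))) \<le> (\<Sum>j. ereal (1 - cmod (d j)))"
    by (simp only: ereal_defect_condition_iff[OF norm_ge_zero le1] simp_thms)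
next
  assume cond: "(\<forall>j. cmod (d j) \<le> 1) \<and>
    ereal (2 * (1 - (INF j. cmod (d j)))) \<le> (\<Sum>j. ereal (1 - cmod (d j)))"
  then have le1: "cmod (d j) \<le> 1" for j by blast
  obtain u where u: "onb u" using exists_onb[OF separable infinite_dim] .
  have polygon: "summable (\<lambda>j. 1 - cmod (d j)) \<Longrightarrow> 2 * (1 - cmod (d k)) \<le> (\<Sum>j. 1 - cmod (d j))" for k
    using cond ereal_defect_condition_iff[of "\<lambda>j. cmod (d j)"] le1 by auto
  show "\<exists>e f. onb e \<and> onb f \<and> (\<forall>j. ip (f j) (e j) = d j)"
  proof (rule exists_onbs[OF u d le1 polygon])
    show "\<exists>e f. onb e \<and> onb f \<and> (\<forall>j. ip (f j) (e j) = d j)"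
      if "onb e" "onb f" "\<And>j. ip (f j) (e j) = d j" for e f
      using that by blast
  qed
qed

lemma onb_image:
  assumes e: "onb e" and U: "\<And>x y. ip (U x) (U y) = ip x y" "surj U"
  shows "onb (\<lambda>j. U (e j))"
proof -
  have "x = 0" if x: "\<And>j. ip x (U (e j)) = 0" for x
  proof -
    obtain y where y: "x = U y" using U(2) by blast
    then have "y = 0" using onb_total[OF e, of y] x U(1) by simp
    then have "ip x x = 0" using y U(1)[of y y] by (simp add: ip_zero)
    then show "x = 0" by (simp add: ip_self)
  qed
  then show ?thesis
    using onb_ip[OF e] U(1) unfolding onb_def orthonormal_on_def by simp
qed

text \<open>The image of \<open>x\<close> has the same coordinates with respect to \<open>f\<close> as \<open>x\<close> has with respect
  to \<open>e\<close>.\<close>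

lemma exists_unitary:
  assumes e: "onb e" and f: "onb f"
  obtains U where "\<And>j. U (e j) = f j" "\<And>x y. ip (U x) (U y) = ip x y" "surj U"
    "\<And>x y. U (x + y) = U x + U y" "\<And>a x. a \<in> K \<Longrightarrow> U (scale a x) = scale a (U x)"
proof -
  have transfer: "\<exists>v. (\<lambda>n. \<Sum>i<n. scale (ip x (e i)) (f i)) \<longlonglongrightarrow> v \<and> (\<forall>j. ip v (f j) = ip x (e j))"
    if e: "onb e" and f: "onb f" for e f x
  proof -
    have f': "orthonormal_on UNIV f" using f by (simp add: onb_def)
    have summable: "summable (\<lambda>i. (cmod (ip x (e i)))\<^sup>2)"
      using onb_expansion(2)[OF e, of x] by (rule sums_summable)
    show ?thesis by (rule orthonormal_series[OF f' ip_in_K summable]) blast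
  qed
  have ext: "v = w" if "\<And>j. ip v (f j) = ip w (f j)" for v w
    using onb_total[OF f, of "v - w"] that by (simp add: ip_diff)
  obtain U where U: "\<And>x. (\<lambda>n. \<Sum>i<n. scale (ip x (e i)) (f i)) \<longlonglongrightarrow> U x"
    "\<And>x j. ip (U x) (f j) = ip x (e j)"
    using transfer[OF e f] by metis
  show ?thesis
  proof (rule that)
    show "U (e j) = f j" for j
      using U(2) onb_ip[OF e] onb_ip[OF f] by (intro ext) simp
    show "U (x + y) = U x + U y" for x y
      using U(2) by (intro ext) (simp add: ip_add)
    show "U (scale a x) = scale a (U x)" if "a \<in> K" for a x
      using U(2) that by (intro ext) (simp add: ip_scale)
    show "surj U"
    proof (rule surjI)
      fix y
      define x where "x = (SOME v. \<forall>j. ip v (e j) = ip y (f j))"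
      have "\<exists>v. \<forall>j. ip v (e j) = ip y (f j)" using transfer[OF f e, of y] by blast
      then have "\<forall>j. ip x (e j) = ip y (f j)" unfolding x_def by (rule someI_ex)
      then show "U (SOME v. \<forall>j. ip v (e j) = ip y (f j)) = y"
        using U(2) unfolding x_def[symmetric] by (intro ext) simp
    qed
    show "ip (U x) (U y) = ip x y" for x y
    proof (rule LIMSEQ_unique)
      have "ip (f i) (U y) = ip (e i) y" for i
        using U(2)[of y i] ip_commute[of "f i"] ip_commute[of "e i"] by metis
      then have "ip (\<Sum>i<n. scale (ip x (e i)) (f i)) (U y) = ip (\<Sum>i<n. scale (ip x (e i)) (e i)) y" for n
        by (simp add: ip_sum ip_scale ip_in_K)
      then show "(\<lambda>n. ip (\<Sum>i<n. scale (ip x (e i)) (e i)) y) \<longlonglongrightarrow> ip (U x) (U y)"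
        using tendsto_ip[OF U(1)[of x], of "U y"] by simp
      show "(\<lambda>n. ip (\<Sum>i<n. scale (ip x (e i)) (e i)) y) \<longlonglongrightarrow> ip x y"
        using onb_expansion(1)[OF e] by (rule tendsto_ip)
    qed
  qed
qed

text \<open>\<open>S\<close> stands for the real or the complex span of \<open>e\<close>, so that completeness in the sense of
  a trivial orthogonal complement amounts to density of the span.\<close>

lemma onb_iff_dense:
  assumes sums: "\<And>(n :: nat) c. (\<Sum>i<n. scale (c i) (e i)) \<in> S"
    and orth: "\<And>x y. y \<in> S \<Longrightarrow> (\<And>j. ip (e j) x = 0) \<Longrightarrow> ip y x = 0"
  shows "onb e \<longleftrightarrow> (\<forall>i j. ip (e i) (e j) = (if i = j then 1 else 0)) \<and> closure S = UNIV"
proof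
  assume e: "onb e"
  have "x \<in> closure S" for x
    unfolding closure_sequential
    by (intro exI[of _ "\<lambda>n. \<Sum>i<n. scale (ip x (e i)) (e i)"]) (simp add: sums onb_expansion(1)[OF e])
  with onb_ip[OF e] show "(\<forall>i j. ip (e i) (e j) = (if i = j then 1 else 0)) \<and> closure S = UNIV"
    by blast
next
  assume *: "(\<forall>i j. ip (e i) (e j) = (if i = j then 1 else 0)) \<and> closure S = UNIV"
  have "x = 0" if x: "\<And>j. ip x (e j) = 0" for x
  proof -
    have "x \<in> closure S" using * by blast
    then obtain y where y: "\<And>n. y n \<in> S" "y \<longlonglongrightarrow> x" unfolding closure_sequential by blast
    have "ip (e j) x = 0" for j using x ip_commute[of "e j" x] by simp
    then have "ip (y n) x = 0" for n using orth y(1) by blast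
    then have "(\<lambda>_. 0) \<longlonglongrightarrow> ip x x" using tendsto_ip[OF y(2), of x] by simp
    then have "ip x x = 0" by (simp add: LIMSEQ_const_iff)
    then show "x = 0" by (simp add: ip_self)
  qed
  with * show "onb e" unfolding onb_def orthonormal_on_def by blast
qed

end

section \<open>Diagonals of unitary and orthogonal operators\<close>

interpretation cplx: hilbert_over UNIV
  "scaleC :: complex \<Rightarrow> 'a::{complex_inner, complete_space} \<Rightarrow> 'a" cinner
proof unfold_locales
  show "cinner x y = cnj (cinner y x)" for x y :: 'a
    by (rule cinner_commute)
qed (simp_all only: UNIV_I cinner_add_left cinner_scaleC_left inner_eq_Re_cinner scaleC_complex_of_real)

interpretation rl: hilbert_over \<real>
  "\<lambda>z x :: 'a::{real_inner, complete_space}. Re z *\<^sub>R x" "\<lambda>x y. complex_of_real (inner x y)"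
proof unfold_locales
  show "complex_of_real (inner x y) = cnj (complex_of_real (inner y x))" for x y :: 'a
    by (simp add: inner_commute)
  show "complex_of_real (inner (Re a *\<^sub>R x) y) = a * complex_of_real (inner x y)"
    if "a \<in> \<real>" for a and x y :: 'a
    using of_real_Re[OF that] by simp
qed (simp_all add: complex_is_Real_iff inner_left_distrib)

lemma complex_onb_iff: "complex_onb e \<longleftrightarrow> cplx.onb e"
proof -
  have "cinner y x = 0" if "y \<in> cspan (range e)" "\<And>j. cinner (e j) x = 0" for x y
    using that(1)
    by (induction rule: complex_vector.span_induct_alt)
      (auto simp: cplx.ip_linear cinner_scaleC_left that(2))
  then show ?thesis
    unfolding complex_onb_def
    by (intro cplx.onb_iff_dense[symmetric])
      (auto intro!: complex_vector.span_sum complex_vector.span_scale intro: complex_vector.span_base)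
qed

lemma real_onb_iff: "real_onb e \<longleftrightarrow> rl.onb e"
proof -
  have "inner y x = 0" if "y \<in> span (range e)" "\<And>j. inner (e j) x = 0" for x y
    using that(1) by (induction rule: span_induct_alt) (auto simp: inner_left_distrib that(2))
  then have "rl.onb e \<longleftrightarrow> (\<forall>i j. complex_of_real (inner (e i) (e j)) = (if i = j then 1 else 0))
      \<and> closure (span (range e)) = UNIV"
    by (intro rl.onb_iff_dense) (auto intro!: span_sum span_scale intro: span_base)
  then show ?thesis
    unfolding real_onb_def by (simp add: if_distrib[of complex_of_real, symmetric])
qed

lemma complex_diagonal_iff:
  fixes d :: "nat \<Rightarrow> complex"
  shows "(\<exists>U :: 'h \<Rightarrow> 'h::{complex_inner, complete_space}. unitary_operator U \<and> complex_diagonal_of d U)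
    \<longleftrightarrow> (\<exists>e f :: nat \<Rightarrow> 'h. cplx.onb e \<and> cplx.onb f \<and> (\<forall>j. cinner (f j) (e j) = d j))"
proof
  assume "\<exists>U :: 'h \<Rightarrow> 'h. unitary_operator U \<and> complex_diagonal_of d U"
  then obtain U :: "'h \<Rightarrow> 'h" and e where U: "unitary_operator U" and
    e: "cplx.onb e" "\<And>j. cinner (U (e j)) (e j) = d j"
    unfolding complex_diagonal_of_def complex_onb_iff by blast
  have "cplx.onb (\<lambda>j. U (e j))"
    using U by (intro cplx.onb_image[OF e(1)]) (simp_all add: unitary_operator_def)
  with e show "\<exists>e f :: nat \<Rightarrow> 'h. cplx.onb e \<and> cplx.onb f \<and> (\<forall>j. cinner (f j) (e j) = d j)"
    by blast
next
  assume "\<exists>e f :: nat \<Rightarrow> 'h. cplx.onb e \<and> cplx.onb f \<and> (\<forall>j. cinner (f j) (e j) = d j)"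
  then obtain e f :: "nat \<Rightarrow> 'h" where
    ef: "cplx.onb e" "cplx.onb f" "\<And>j. cinner (f j) (e j) = d j" by blast
  obtain U where U: "\<And>j. U (e j) = f j" "\<And>x y. cinner (U x) (U y) = cinner x y" "surj U"
    "\<And>x y. U (x + y) = U x + U y" "\<And>a x. U (a *\<^sub>C x) = a *\<^sub>C U x"
    using cplx.exists_unitary[OF ef(1,2)] by auto
  then have "unitary_operator U"
    unfolding unitary_operator_def
    by (simp add: Vector_Spaces.linear_iff complex_vector.vector_space_axioms)
  moreover have "complex_diagonal_of d U"
    unfolding complex_diagonal_of_def complex_onb_iff using ef(1,3) U(1) by metis
  ultimately show "\<exists>U :: 'h \<Rightarrow> 'h. unitary_operator U \<and> complex_diagonal_of d U" by blast
qed

lemma real_diagonal_iff: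
  fixes d :: "nat \<Rightarrow> real"
  shows "(\<exists>U :: 'r \<Rightarrow> 'r::{real_inner, complete_space}. orthogonal_operator U \<and> real_diagonal_of d U)
    \<longleftrightarrow> (\<exists>e f :: nat \<Rightarrow> 'r. rl.onb e \<and> rl.onb f \<and> (\<forall>j. inner (f j) (e j) = d j))"
proof
  assume "\<exists>U :: 'r \<Rightarrow> 'r. orthogonal_operator U \<and> real_diagonal_of d U"
  then obtain U :: "'r \<Rightarrow> 'r" and e where U: "orthogonal_operator U" and
    e: "rl.onb e" "\<And>j. inner (U (e j)) (e j) = d j"
    unfolding real_diagonal_of_def real_onb_iff by blast
  have "rl.onb (\<lambda>j. U (e j))"
    using U by (intro rl.onb_image[OF e(1)])
      (simp_all add: orthogonal_operator_def orthogonal_transformation_def)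
  with e show "\<exists>e f :: nat \<Rightarrow> 'r. rl.onb e \<and> rl.onb f \<and> (\<forall>j. inner (f j) (e j) = d j)"
    by blast
next
  assume "\<exists>e f :: nat \<Rightarrow> 'r. rl.onb e \<and> rl.onb f \<and> (\<forall>j. inner (f j) (e j) = d j)"
  then obtain e f :: "nat \<Rightarrow> 'r" where
    ef: "rl.onb e" "rl.onb f" "\<And>j. inner (f j) (e j) = d j" by blast
  obtain U where U: "\<And>j. U (e j) = f j"
    "\<And>x y. complex_of_real (inner (U x) (U y)) = complex_of_real (inner x y)" "surj U"
    "\<And>x y. U (x + y) = U x + U y" "\<And>a x. a \<in> \<real> \<Longrightarrow> U (Re a *\<^sub>R x) = Re a *\<^sub>R U x"
    using rl.exists_unitary[OF ef(1,2)] by blast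
  have "U (r *\<^sub>R x) = r *\<^sub>R U x" for r x using U(5)[of "complex_of_real r" x] by simp
  then have "orthogonal_operator U"
    using U unfolding orthogonal_operator_def orthogonal_transformation_def
    by (simp add: linear_iff)
  moreover have "real_diagonal_of d U"
    unfolding real_diagonal_of_def real_onb_iff using ef(1,3) U(1) by metis
  ultimately show "\<exists>U :: 'r \<Rightarrow> 'r. orthogonal_operator U \<and> real_diagonal_of d U" by blast
qed

theorem theorem4p3:
  fixes d :: "nat \<Rightarrow> complex"
  shows "(separable_space (euclidean :: 'h::{complex_inner, complete_space} topology) \<and>
          (\<nexists>B :: 'h set. finite B \<and> cspan B = UNIV) \<longrightarrow>
            ((\<exists>U :: 'h \<Rightarrow> 'h. unitary_operator U \<and> complex_diagonal_of d U) \<longleftrightarrow>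
              (\<forall>j. cmod (d j) \<le> 1) \<and>
              ereal (2 * (1 - (INF j. cmod (d j)))) \<le> (\<Sum>j. ereal (1 - cmod (d j))))) \<and>
         (separable_space (euclidean :: 'r::{real_inner, complete_space} topology) \<and>
          (\<nexists>B :: 'r set. finite B \<and> span B = UNIV) \<longrightarrow>
          (\<forall>j. d j \<in> \<real>) \<longrightarrow>
            ((\<exists>U :: 'r \<Rightarrow> 'r. orthogonal_operator U \<and> real_diagonal_of (\<lambda>j. Re (d j)) U) \<longleftrightarrow>
              (\<forall>j. cmod (d j) \<le> 1) \<and>
              ereal (2 * (1 - (INF j. cmod (d j)))) \<le> (\<Sum>j. ereal (1 - cmod (d j)))))"
proof (intro conjI impI)
  assume H: "separable_space (euclidean :: 'h topology) \<and> (\<nexists>B :: 'h set. finite B \<and> cspan B = UNIV)"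
  have "\<exists>x. x \<noteq> (\<Sum>b\<in>B. cinner x b *\<^sub>C b)" if "finite B" for B :: "'h set"
  proof (rule ccontr)
    assume "\<nexists>x. x \<noteq> (\<Sum>b\<in>B. cinner x b *\<^sub>C b)"
    then have "x = (\<Sum>b\<in>B. cinner x b *\<^sub>C b)" for x by blast
    moreover have "(\<Sum>b\<in>B. cinner x b *\<^sub>C b) \<in> cspan B" for x
      by (intro complex_vector.span_sum complex_vector.span_scale complex_vector.span_base)
    ultimately have "x \<in> cspan B" for x by (rule ssubst)
    then show False using H that by blast
  qed
  then show "(\<exists>U :: 'h \<Rightarrow> 'h. unitary_operator U \<and> complex_diagonal_of d U) \<longleftrightarrow>
      (\<forall>j. cmod (d j) \<le> 1) \<and>
      ereal (2 * (1 - (INF j. cmod (d j)))) \<le> (\<Sum>j. ereal (1 - cmod (d j)))"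
    unfolding complex_diagonal_iff using H by (intro cplx.exists_onb_pair_iff) auto
next
  assume H: "separable_space (euclidean :: 'r topology) \<and> (\<nexists>B :: 'r set. finite B \<and> span B = UNIV)"
    and d: "\<forall>j. d j \<in> \<real>"
  have infinite_dim: "\<exists>x. x \<noteq> (\<Sum>b\<in>B. inner x b *\<^sub>R b)" if "finite B" for B :: "'r set"
  proof (rule ccontr)
    assume "\<nexists>x. x \<noteq> (\<Sum>b\<in>B. inner x b *\<^sub>R b)"
    then have "x = (\<Sum>b\<in>B. inner x b *\<^sub>R b)" for x by blast
    moreover have "(\<Sum>b\<in>B. inner x b *\<^sub>R b) \<in> span B" for x
      by (intro span_sum span_scale span_base)
    ultimately have "x \<in> span B" for x by (rule ssubst)
    then show False using H that by blast
  qed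
  have "inner x y = Re (d j) \<longleftrightarrow> complex_of_real (inner x y) = d j" for x y :: 'r and j
    using of_real_Re[of "d j"] d by (metis Re_complex_of_real)
  moreover have "(\<exists>e f :: nat \<Rightarrow> 'r. rl.onb e \<and> rl.onb f
        \<and> (\<forall>j. complex_of_real (inner (f j) (e j)) = d j)) \<longleftrightarrow>
      (\<forall>j. cmod (d j) \<le> 1) \<and>
      ereal (2 * (1 - (INF j. cmod (d j)))) \<le> (\<Sum>j. ereal (1 - cmod (d j)))"
    using H d infinite_dim by (intro rl.exists_onb_pair_iff) simp_all
  ultimately show "(\<exists>U :: 'r \<Rightarrow> 'r. orthogonal_operator U \<and> real_diagonal_of (\<lambda>j. Re (d j)) U) \<longleftrightarrow>
      (\<forall>j. cmod (d j) \<le> 1) \<and>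
      ereal (2 * (1 - (INF j. cmod (d j)))) \<le> (\<Sum>j. ereal (1 - cmod (d j)))"
    unfolding real_diagonal_iff by (simp only:)
qed

end
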